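(* Let $n\ge1$, let $\lambda,\mu$ be partitions with $\mu_1\le n$, and let $v_{\widetilde\mu}$ be a highest weight vector of the irreducible $gl(n)$-module $Schur_\mu(n)$ of highest weight $\widetilde\mu$. Then: (i) if $|\mu|<|\lambda|$, then $\mathbf{J}_\lambda(n)(v_{\widetilde\mu})=0$; (ii) if $|\mu|=|\lambda|$ and $\widetilde\mu\ntrianglerighteq\lambda$, then $\mathbf{J}_\lambda(n)(v_{\widetilde\mu})=0$, where $\trianglelefteq$ is the dominance order on partitions.
   Context: Virtual method. $gl(m_0|m_1+n)$ ($m_0,m_1$ sufficiently large) is the complex general linear Lie superalgebra with basis $e_{a,b}$, $a,b\in A_0\cup A_1\cup L$, $A_0=\{\alpha_1,\dots,\alpha_{m_0}\}$ (parity $0$), $A_1=\{\beta_1,\dots,\beta_{m_1}\}$ (parity $1$), $L=\{1,\dots,n\}$ (parity $1$), $|e_{a,b}|=|a|+|b|$, and $[e_{a,b},e_{c,d}]=\delta_{bc}e_{a,d}-(-1)^{(|a|+|b|)(|c|+|d|)}\delta_{ad}e_{c,b}$. Symbols in $A_0\cup A_1$ are virtual. $gl(n)$ is the subalgebra spanned by $e_{i,j}$, $i,j\in L$, so $\mathbf{U}(gl(n))\subset\mathbf{U}(gl(m_0|m_1+n))$. A product $e_{a_M,b_M}\cdots e_{a_1,b_1}$ is irregular if there are $i\le M$ and a virtual symbol $\gamma$ with $\#\{j\le i: b_j=\gamma\}>\#\{j<i: a_j=\gamma\}$. Let $\mathbf{Irr}$ be the left ideal of $\mathbf{U}(gl(m_0|m_1+n))$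 generated by irregular products. The sum $Virt(m_0+m_1,n)=\mathbf{U}(gl(n))\oplus\mathbf{Irr}$ is direct and is a subalgebra in which $\mathbf{Irr}$ is a two-sided ideal; $\mathfrak p:Virt(m_0+m_1,n)\to\mathbf{U}(gl(n))$ is the projection with kernel $\mathbf{Irr}$ (an algebra epimorphism). All monomials to which $\mathfrak p$ is applied here lie in $Virt(m_0+m_1,n)$. Tableaux. For two Young tableaux $S,T$ of the same shape $\nu$ (row $i$ has $\nu_i$ cells), $e_{S,T}$ is the product of the $e_{s,t}$, $s,t$ being the entries of $S,T$ in the same cell, the cells being read row by row from top to bottom and from left to right in each row. $D^*_\nu$ is the tableau of shape $\nu$ all of whose entries in column $j$ equal $\beta_j$ ($m_1\ge\nu_1$). For any partition $\lambda$ with conjugate $\widetilde\lambda$, $$\mathbf{J}_\lambda(n)=\sum_S\frac1{o_S}\,\mathfrak p\big(e_{S,D^*_{\widetilde\lambda}}\cdot e_{D^*_{\widetilde\lambda},S}\big)\in\mathbf{U}(gl(n)),$$ the sum being over all tableaux $S$ of shape $\widetilde\lambda$ with entries in $\{1,\dots,n\}$ whose columns are weakly increasing from top to bottom, where $o_S$ is the product, over all columns and all symbols, of the factorials of the number of repetitions of the symbol in the column; $\mathbf{J}_\emptyset(n)=1$. These elements are central in $\mathbf{U}(gl(n))$. For a partition $\mu$ with $\mu_1\le n$, $Schur_\mu(n)$ is the irreducible $gl(n)$-module of highest weight $\widetilde\mu$ (the conjugate partition, padded by zeros to length $n$). *)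

theory Defs
  imports Complex_Main "HOL-Library.Poly_Mapping" "HOL-Library.More_List"
    "HOL-Library.FuncSet" "HOL-Algebra.QuotRing"
begin

section \<open>Partitions\<close>

text \<open>A partition is the list of its nonzero parts. Rows, columns, and all the symbols below are
  indexed from \<open>0\<close>.\<close>

definition is_partition :: "nat list \<Rightarrow> bool" where
  "is_partition p \<longleftrightarrow> sorted_wrt (\<ge>) p \<and> 0 \<notin> set p"

definition part :: "nat list \<Rightarrow> nat \<Rightarrow> nat" where
  "part p i = nth_default 0 p i"

definition conj_partition :: "nat list \<Rightarrow> nat list" where
  "conj_partition p = map (\<lambda>j. card {i. i < length p \<and> j < p ! i}) [0..<part p 0]"

definition dominated_by :: "nat list \<Rightarrow> nat list \<Rightarrow> bool" where
  "dominated_by p q \<longleftrightarrow>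
     sum_list p = sum_list q \<and> (\<forall>k. (\<Sum>i<k. part p i) \<le> (\<Sum>i<k. part q i))"


section \<open>Free algebras and enveloping algebras\<close>

datatype symbol = Alpha nat | Beta nat | Letter nat

fun parity :: "symbol \<Rightarrow> nat" where
  "parity (Alpha i) = 0"
| "parity (Beta i) = 1"
| "parity (Letter i) = 1"

definition virtual_symbols :: "nat \<Rightarrow> nat \<Rightarrow> symbol set" where
  "virtual_symbols m0 m1 = Alpha ` {..<m0} \<union> Beta ` {..<m1}"

definition proper_symbols :: "nat \<Rightarrow> symbol set" where
  "proper_symbols n = Letter ` {..<n}"

definition all_symbols :: "nat \<Rightarrow> nat \<Rightarrow> nat \<Rightarrow> symbol set" where
  "all_symbols m0 m1 n = virtual_symbols m0 m1 \<union> proper_symbols n"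

text \<open>Words in the basis elements \<open>e\<^sub>a\<^sub>,\<^sub>b\<close>, represented by the pairs \<open>(a, b)\<close>. They form a monoid
  under concatenation, so that the convolution product of \<^typ>\<open>'a \<Rightarrow>\<^sub>0 complex\<close> is the
  multiplication of the free associative algebra.\<close>

datatype gl_word = Word (letters: "(symbol \<times> symbol) list")

instantiation gl_word :: monoid_add
begin

definition zero_gl_word :: gl_word where
  "0 = Word []"

definition plus_gl_word :: "gl_word \<Rightarrow> gl_word \<Rightarrow> gl_word" where
  "v + w = Word (letters v @ letters w)"

instance
  by standard (simp_all add: zero_gl_word_def plus_gl_word_def)

end

type_synonym gl_free = "gl_word \<Rightarrow>\<^sub>0 complex"

definition gl_monomial :: "(symbol \<times> symbol) list \<Rightarrow> gl_free" where
  "gl_monomial w = Poly_Mapping.single (Word w) 1"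

definition gl_scalar :: "complex \<Rightarrow> gl_free" where
  "gl_scalar c = Poly_Mapping.single 0 c"

abbreviation gl_gen :: "symbol \<Rightarrow> symbol \<Rightarrow> gl_free" where
  "gl_gen a b \<equiv> gl_monomial [(a, b)]"

definition free_algebra :: "symbol set \<Rightarrow> gl_free ring" where
  "free_algebra X =
     \<lparr>carrier = {p. \<forall>w \<in> Poly_Mapping.keys p. set (letters w) \<subseteq> X \<times> X},
      mult = (*), one = 1, zero = 0, add = (+)\<rparr>"

definition super_sign :: "symbol \<times> symbol \<Rightarrow> symbol \<times> symbol \<Rightarrow> gl_free" where
  "super_sign = (\<lambda>(a, b) (c, d). (- 1) ^ ((parity a + parity b) * (parity c + parity d)))"

definition gl_bracket :: "symbol \<times> symbol \<Rightarrow> symbol \<times> symbol \<Rightarrow> gl_free" where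
  "gl_bracket = (\<lambda>(a, b) (c, d).
     (if b = c then gl_gen a d else 0)
     - super_sign (a, b) (c, d) * (if a = d then gl_gen c b else 0))"

definition gl_relations :: "symbol set \<Rightarrow> gl_free set" where
  "gl_relations X =
     {gl_gen a b * gl_gen c d - super_sign (a, b) (c, d) * (gl_gen c d * gl_gen a b)
        - gl_bracket (a, b) (c, d) | a b c d. a \<in> X \<and> b \<in> X \<and> c \<in> X \<and> d \<in> X}"

definition gl_ideal :: "symbol set \<Rightarrow> gl_free set" where
  "gl_ideal X = Idl\<^bsub>free_algebra X\<^esub> (gl_relations X)"

text \<open>The enveloping algebra of the general linear Lie superalgebra with basis \<open>e\<^sub>a\<^sub>,\<^sub>b\<close>,
  \<open>a, b \<in> X\<close>: the tensor algebra of the superalgebra modulo the supercommutator relations, which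
  need only be imposed on the basis. \<open>X = all_symbols m0 m1 n\<close> gives \<open>U(gl(m0|m1+n))\<close> and
  \<open>X = proper_symbols n\<close> gives \<open>U(gl(n))\<close>.\<close>

definition gl_UEA :: "symbol set \<Rightarrow> gl_free set ring" where
  "gl_UEA X = free_algebra X Quot gl_ideal X"

definition UEA_class :: "symbol set \<Rightarrow> gl_free \<Rightarrow> gl_free set" where
  "UEA_class X p = gl_ideal X +>\<^bsub>free_algebra X\<^esub> p"

text \<open>The canonical homomorphism from \<open>U(gl(n))\<close> to \<open>U(gl(m0|m1+n))\<close>: the coset of \<open>p\<close> is sent to
  the larger coset of \<open>p\<close>.\<close>

definition UEA_embed :: "nat \<Rightarrow> nat \<Rightarrow> nat \<Rightarrow> gl_free set \<Rightarrow> gl_free set" where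
  "UEA_embed m0 m1 n u =
     gl_ideal (all_symbols m0 m1 n) <+>\<^bsub>free_algebra (all_symbols m0 m1 n)\<^esub> u"


section \<open>Irregular products and the projection\<close>

definition left_ideal :: "'a set \<Rightarrow> ('a, 'b) ring_scheme \<Rightarrow> bool" where
  "left_ideal I R \<longleftrightarrow>
     additive_subgroup I R \<and> (\<forall>x \<in> carrier R. \<forall>a \<in> I. x \<otimes>\<^bsub>R\<^esub> a \<in> I)"

definition left_genideal :: "('a, 'b) ring_scheme \<Rightarrow> 'a set \<Rightarrow> 'a set" where
  "left_genideal R S = \<Inter>{I. left_ideal I R \<and> S \<subseteq> I}"

text \<open>The factors of a product are counted from right to left, hence \<^const>\<open>rev\<close>.\<close>

definition irregular :: "nat \<Rightarrow> nat \<Rightarrow> (symbol \<times> symbol) list \<Rightarrow> bool" where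
  "irregular m0 m1 w \<longleftrightarrow>
     (\<exists>i < length w. \<exists>\<gamma> \<in> virtual_symbols m0 m1.
        card {j. j \<le> i \<and> snd (rev w ! j) = \<gamma>} > card {j. j < i \<and> fst (rev w ! j) = \<gamma>})"

definition Irr :: "nat \<Rightarrow> nat \<Rightarrow> nat \<Rightarrow> gl_free set set" where
  "Irr m0 m1 n =
     (let X = all_symbols m0 m1 n in
      left_genideal (gl_UEA X)
        {UEA_class X (gl_monomial w) | w. set w \<subseteq> X \<times> X \<and> irregular m0 m1 w})"

text \<open>On the virtual algebra \<open>U(gl(n)) \<oplus> Irr\<close> the component \<open>u\<close> exists and is unique, as the sum
  is direct and the canonical homomorphism from \<open>U(gl(n))\<close> is injective. Outside it the value is
  irrelevant.\<close>

definition virt_proj :: "nat \<Rightarrow> nat \<Rightarrow> nat \<Rightarrow> gl_free set \<Rightarrow> gl_free set" where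
  "virt_proj m0 m1 n x =
     (SOME u. u \<in> carrier (gl_UEA (proper_symbols n)) \<and>
        x \<ominus>\<^bsub>gl_UEA (all_symbols m0 m1 n)\<^esub> UEA_embed m0 m1 n u \<in> Irr m0 m1 n)"


section \<open>Tableaux and the elements \<open>J\<^sub>\<lambda>(n)\<close>\<close>

text \<open>The cells (row, column) of a shape, read row by row from top to bottom and from left to
  right.\<close>

definition cells :: "nat list \<Rightarrow> (nat \<times> nat) list" where
  "cells \<nu> = concat (map (\<lambda>i. map (\<lambda>j. (i, j)) [0..<\<nu> ! i]) [0..<length \<nu>])"

definition tableau_monomial ::
    "nat list \<Rightarrow> (nat \<times> nat \<Rightarrow> symbol) \<Rightarrow> (nat \<times> nat \<Rightarrow> symbol) \<Rightarrow> gl_free" where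
  "tableau_monomial \<nu> S T = gl_monomial (map (\<lambda>c. (S c, T c)) (cells \<nu>))"

definition dstar :: "nat \<times> nat \<Rightarrow> symbol" where
  "dstar = (\<lambda>(i, j). Beta j)"

definition column_tableaux :: "nat \<Rightarrow> nat list \<Rightarrow> (nat \<times> nat \<Rightarrow> nat) set" where
  "column_tableaux n \<nu> =
     {S \<in> set (cells \<nu>) \<rightarrow>\<^sub>E {..<n}.
        \<forall>i i' j. (i, j) \<in> set (cells \<nu>) \<and> (i', j) \<in> set (cells \<nu>) \<and> i \<le> i'
          \<longrightarrow> S (i, j) \<le> S (i', j)}"

definition col_fact :: "nat \<Rightarrow> nat list \<Rightarrow> (nat \<times> nat \<Rightarrow> nat) \<Rightarrow> nat" where
  "col_fact n \<nu> S =
     (\<Prod>j<part \<nu> 0. \<Prod>s<n. fact (card {i. (i, j) \<in> set (cells \<nu>) \<and> S (i, j) = s}))"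

definition J :: "nat \<Rightarrow> nat \<Rightarrow> nat \<Rightarrow> nat list \<Rightarrow> gl_free set" where
  "J m0 m1 n lam =
     (let X = all_symbols m0 m1 n; L = proper_symbols n; \<nu> = conj_partition lam in
      if lam = [] then \<one>\<^bsub>gl_UEA L\<^esub>
      else \<Oplus>\<^bsub>gl_UEA L\<^esub> S \<in> column_tableaux n \<nu>.
        UEA_class L (gl_scalar (1 / of_nat (col_fact n \<nu> S))) \<otimes>\<^bsub>gl_UEA L\<^esub>
        virt_proj m0 m1 n
          (UEA_class X (tableau_monomial \<nu> (Letter \<circ> S) dstar) \<otimes>\<^bsub>gl_UEA X\<^esub>
           UEA_class X (tableau_monomial \<nu> dstar (Letter \<circ> S))))"


section \<open>Modules over \<open>gl(n)\<close>\<close>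

text \<open>The module is the whole type \<open>'v\<close> with scalar multiplication \<open>scale\<close>, and \<open>\<rho> a b\<close> is the
  action of \<open>e\<^sub>a\<^sub>,\<^sub>b\<close>. All letters have the same parity, so \<open>gl(n)\<close> is purely even and the signs
  in the bracket are trivial.\<close>

definition gl_module ::
    "nat \<Rightarrow> (complex \<Rightarrow> 'v::ab_group_add \<Rightarrow> 'v) \<Rightarrow> (symbol \<Rightarrow> symbol \<Rightarrow> 'v \<Rightarrow> 'v) \<Rightarrow> bool" where
  "gl_module n scale \<rho> \<longleftrightarrow>
     vector_space scale \<and>
     (\<forall>a \<in> proper_symbols n. \<forall>b \<in> proper_symbols n. Vector_Spaces.linear scale scale (\<rho> a b)) \<and>
     (\<forall>a \<in> proper_symbols n. \<forall>b \<in> proper_symbols n.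
      \<forall>c \<in> proper_symbols n. \<forall>d \<in> proper_symbols n. \<forall>x.
        \<rho> a b (\<rho> c d x) - \<rho> c d (\<rho> a b x) =
          (if b = c then \<rho> a d x else 0) - (if a = d then \<rho> c b x else 0))"

definition irreducible_gl_module ::
    "nat \<Rightarrow> (complex \<Rightarrow> 'v::ab_group_add \<Rightarrow> 'v) \<Rightarrow> (symbol \<Rightarrow> symbol \<Rightarrow> 'v \<Rightarrow> 'v) \<Rightarrow> bool" where
  "irreducible_gl_module n scale \<rho> \<longleftrightarrow>
     gl_module n scale \<rho> \<and> (\<exists>x::'v. x \<noteq> 0) \<and>
     (\<forall>W. module.subspace scale W \<and>
          (\<forall>a \<in> proper_symbols n. \<forall>b \<in> proper_symbols n. \<rho> a b ` W \<subseteq> W)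
        \<longrightarrow> W = {0} \<or> W = UNIV)"

definition highest_weight_vector ::
    "nat \<Rightarrow> (complex \<Rightarrow> 'v::ab_group_add \<Rightarrow> 'v) \<Rightarrow> (symbol \<Rightarrow> symbol \<Rightarrow> 'v \<Rightarrow> 'v) \<Rightarrow>
     (nat \<Rightarrow> complex) \<Rightarrow> 'v \<Rightarrow> bool" where
  "highest_weight_vector n scale \<rho> wt v \<longleftrightarrow>
     v \<noteq> 0 \<and>
     (\<forall>i j. i < j \<and> j < n \<longrightarrow> \<rho> (Letter i) (Letter j) v = 0) \<and>
     (\<forall>i<n. \<rho> (Letter i) (Letter i) v = scale (wt i) v)"

definition schur_weight :: "nat list \<Rightarrow> nat \<Rightarrow> complex" where
  "schur_weight \<mu> i = of_nat (part (conj_partition \<mu>) i)"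

text \<open>A model of \<open>Schur\<^sub>\<mu>(n)\<close>, which is determined up to isomorphism.\<close>

definition schur_module ::
    "nat \<Rightarrow> nat list \<Rightarrow> (complex \<Rightarrow> 'v::ab_group_add \<Rightarrow> 'v) \<Rightarrow> (symbol \<Rightarrow> symbol \<Rightarrow> 'v \<Rightarrow> 'v) \<Rightarrow>
     bool" where
  "schur_module n \<mu> scale \<rho> \<longleftrightarrow>
     irreducible_gl_module n scale \<rho> \<and>
     (\<exists>v. highest_weight_vector n scale \<rho> (schur_weight \<mu>) v)"

definition free_act ::
    "(complex \<Rightarrow> 'v::ab_group_add \<Rightarrow> 'v) \<Rightarrow> (symbol \<Rightarrow> symbol \<Rightarrow> 'v \<Rightarrow> 'v) \<Rightarrow> gl_free \<Rightarrow> 'v \<Rightarrow> 'v" where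
  "free_act scale \<rho> p x =
     (\<Sum>w \<in> Poly_Mapping.keys p.
        scale (Poly_Mapping.lookup p w) (foldr (\<lambda>(a, b). \<rho> a b) (letters w) x))"

text \<open>The action of \<open>U(gl(n))\<close> on a \<open>gl(n)\<close>-module, which does not depend on the chosen
  representative.\<close>

definition UEA_act ::
    "(complex \<Rightarrow> 'v::ab_group_add \<Rightarrow> 'v) \<Rightarrow> (symbol \<Rightarrow> symbol \<Rightarrow> 'v \<Rightarrow> 'v) \<Rightarrow>
     gl_free set \<Rightarrow> 'v \<Rightarrow> 'v" where
  "UEA_act scale \<rho> u x = free_act scale \<rho> (SOME p. p \<in> u) x"

end

theory Submission
  imports "HOL-Library.Function_Algebras" "HOL-Library.Product_Plus"
    "HOL-Combinatorics.Permutations" Defs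
begin

text \<open>Moving the virtual annihilators to the right shows that a product of degree zero in the
  virtual symbols lies in \<open>U(gl(n)) + Irr\<close>, so that \<^const>\<open>virt_proj\<close> returns some
  \<open>u\<close> with the defining property. No uniqueness is needed: let \<open>gl(m0|m1+n)\<close> act on the tensors of
  degree \<open>|\<mu>|\<close> and let \<open>w\<close> be the product of the determinants given by the rows of \<open>\<mu>\<close>, which is
  a highest weight vector for \<open>gl(n)\<close> of the same weight as \<open>v\<close>. It contains no virtual symbol, hence
  is killed by \<open>Irr\<close>, so \<open>u\<close> acts on it as \<open>e\<^bsub>S,D*\<^esub> e\<^bsub>D*,S\<^esub>\<close>. In \<open>e\<^bsub>D*,S\<^esub> w\<close> the symbol \<open>\<beta>\<^sub>j\<close> occurs
  \<open>\<lambda>\<^sub>j\<close> times, and by antisymmetry at most once in each row of \<open>\<mu>\<close>. By the easy half of the Gale-Ryser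
  theorem this vanishes unless \<open>|\<lambda>| \<le> |\<mu>|\<close>, with \<open>\<lambda>\<close> dominated by the conjugate of \<open>\<mu>\<close> in case of
  equality. Finally every element of \<open>U(gl(n))\<close> that kills \<open>w\<close> kills the highest weight vector \<open>v\<close> of the
  irreducible module.\<close>

section \<open>Free and enveloping algebras\<close>

text \<open>A finitely supported function is the sum of its monomials. The support bound is carried
  through the additive case so that facts requiring membership in a free algebra stay available
  there.\<close>

lemma keys_induct [consumes 1, case_names zero single add]:
  fixes p :: "'a \<Rightarrow>\<^sub>0 'b::comm_monoid_add"
  assumes "Poly_Mapping.keys p \<subseteq> A"
    and "P 0"
    and "\<And>w c. w \<in> A \<Longrightarrow> P (Poly_Mapping.single w c)"
    and "\<And>p q. Poly_Mapping.keys p \<subseteq> A \<Longrightarrow> Poly_Mapping.keys q \<subseteq> A \<Longrightarrow> P p \<Longrightarrow> P q \<Longrightarrow> P (p + q)"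
  shows "P p"
proof -
  let ?s = "\<lambda>W. \<Sum>w\<in>W. Poly_Mapping.single w (Poly_Mapping.lookup p w)"
  have "P (?s W) \<and> Poly_Mapping.keys (?s W) \<subseteq> A" if "finite W" "W \<subseteq> A" for W
    using that
  proof (induction W rule: finite_induct)
    case (insert w W)
    then have "Poly_Mapping.keys (?s (insert w W)) \<subseteq> A"
      using keys_add[of "Poly_Mapping.single w (Poly_Mapping.lookup p w)" "?s W"]
      by (auto split: if_splits)
    with insert show ?case by (auto intro!: assms(4) assms(3) split: if_splits)
  qed (use assms in auto)
  moreover have "p = ?s (Poly_Mapping.keys p)"
    by (rule poly_mapping_eqI)
      (auto simp: lookup_sum lookup_single when_def in_keys_iff sum.delta if_distrib cong: if_cong)
  ultimately show ?thesis using assms(1) by (metis finite_keys)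
qed

lemma free_algebra_simps [simp]:
  "mult (free_algebra X) = (*)" "one (free_algebra X) = 1"
  "zero (free_algebra X) = 0" "add (free_algebra X) = (+)"
  by (simp_all add: free_algebra_def)

definition words :: "symbol set \<Rightarrow> gl_word set" where
  "words X = {w. set (letters w) \<subseteq> X \<times> X}"

lemma carrier_free_algebra: "carrier (free_algebra X) = {p. Poly_Mapping.keys p \<subseteq> words X}"
  by (auto simp: free_algebra_def words_def)

lemma words_add: "v \<in> words X \<Longrightarrow> w \<in> words X \<Longrightarrow> v + w \<in> words X"
  by (auto simp: words_def plus_gl_word_def)

lemma words_zero: "0 \<in> words X"
  by (simp add: words_def zero_gl_word_def)

lemma free_algebra_closed:
  shows "0 \<in> carrier (free_algebra X)" "1 \<in> carrier (free_algebra X)"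
    and "p \<in> carrier (free_algebra X) \<Longrightarrow> q \<in> carrier (free_algebra X) \<Longrightarrow> p + q \<in> carrier (free_algebra X)"
    and "p \<in> carrier (free_algebra X) \<Longrightarrow> q \<in> carrier (free_algebra X) \<Longrightarrow> p - q \<in> carrier (free_algebra X)"
    and "p \<in> carrier (free_algebra X) \<Longrightarrow> - p \<in> carrier (free_algebra X)"
    and "p \<in> carrier (free_algebra X) \<Longrightarrow> q \<in> carrier (free_algebra X) \<Longrightarrow> p * q \<in> carrier (free_algebra X)"
    and "w \<in> words X \<Longrightarrow> Poly_Mapping.single w c \<in> carrier (free_algebra X)"
  unfolding carrier_free_algebra
  subgoal by simp
  subgoal by (simp add: words_zero)
  subgoal using keys_add[of p q] by auto
  subgoal unfolding mem_Collect_eq subset_iff in_keys_iff lookup_minus by (metis diff_self)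
  subgoal by (auto simp: in_keys_iff)
  subgoal using keys_mult[of p q] words_add by blast
  subgoal by simp
  done

lemma gl_scalar_closed: "gl_scalar c \<in> carrier (free_algebra X)"
  by (auto simp: gl_scalar_def free_algebra_closed words_zero)

lemma gl_monomial_closed: "set w \<subseteq> X \<times> X \<Longrightarrow> gl_monomial w \<in> carrier (free_algebra X)"
  by (auto simp: gl_monomial_def words_def intro!: free_algebra_closed)

lemma ring_free_algebra: "ring (free_algebra X)"
proof (rule ringI)
  show "abelian_group (free_algebra X)"
    by (rule abelian_groupI)
      (auto simp: free_algebra_closed algebra_simps intro: bexI[of _ "- _"])
  show "Group.monoid (free_algebra X)"
    by (rule monoidI) (auto simp: free_algebra_closed algebra_simps)
qed (auto simp: algebra_simps)

lemma a_inv_free_algebra: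
  assumes "p \<in> carrier (free_algebra X)"
  shows "\<ominus>\<^bsub>free_algebra X\<^esub> p = - p"
proof -
  interpret ring "free_algebra X" by (rule ring_free_algebra)
  have "- p \<oplus>\<^bsub>free_algebra X\<^esub> p = \<zero>\<^bsub>free_algebra X\<^esub>" by simp
  then show ?thesis using assms minus_equality free_algebra_closed(5) by metis
qed

text \<open>Turns a sign, written as a power in the free algebra, into a scalar, so that the rules
  for scalars under \<open>act\<close> and \<open>normal_span\<close> apply to it.\<close>

lemma super_sign_eq:
  "super_sign (a, b) (c, d) = gl_scalar ((- 1) ^ ((parity a + parity b) * (parity c + parity d)))"
proof -
  have "(- 1) ^ k = gl_scalar ((- 1) ^ k)" for k
    by (cases "even k") (simp_all add: gl_scalar_def single_uminus)
  then show ?thesis by (simp add: super_sign_def)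
qed

lemma gl_bracket_closed:
  assumes "a \<in> X" "b \<in> X" "c \<in> X" "d \<in> X"
  shows "gl_bracket (a, b) (c, d) \<in> carrier (free_algebra X)"
  unfolding gl_bracket_def prod.case super_sign_eq
  by (intro free_algebra_closed(4,6) gl_scalar_closed)
    (simp_all add: assms gl_monomial_closed free_algebra_closed(1))

lemma gl_relations_closed: "gl_relations X \<subseteq> carrier (free_algebra X)"
proof
  fix r assume "r \<in> gl_relations X"
  then obtain a b c d where abcd: "a \<in> X" "b \<in> X" "c \<in> X" "d \<in> X"
    and r: "r = gl_gen a b * gl_gen c d - super_sign (a, b) (c, d) * (gl_gen c d * gl_gen a b)
      - gl_bracket (a, b) (c, d)"
    by (auto simp: gl_relations_def)
  show "r \<in> carrier (free_algebra X)"
    unfolding r super_sign_eq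
    by (intro free_algebra_closed(4,6) gl_scalar_closed gl_bracket_closed gl_monomial_closed)
      (simp_all add: abcd)
qed

lemma ideal_gl_ideal: "ideal (gl_ideal X) (free_algebra X)"
  unfolding gl_ideal_def
  by (rule ring.genideal_ideal[OF ring_free_algebra gl_relations_closed])

lemma gl_relations_in_ideal: "gl_relations X \<subseteq> gl_ideal X"
  unfolding gl_ideal_def
  by (rule ring.genideal_self[OF ring_free_algebra gl_relations_closed])

lemma ring_gl_UEA: "ring (gl_UEA X)"
  unfolding gl_UEA_def by (rule ideal.quotient_is_ring[OF ideal_gl_ideal])

lemma UEA_class_hom: "UEA_class X \<in> ring_hom (free_algebra X) (gl_UEA X)"
proof -
  have "UEA_class X = (+>\<^bsub>free_algebra X\<^esub>) (gl_ideal X)" by (auto simp: UEA_class_def)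
  then show ?thesis
    unfolding gl_UEA_def using ideal.rcos_ring_hom[OF ideal_gl_ideal] by simp
qed

lemma UEA_class_add:
  "p \<in> carrier (free_algebra X) \<Longrightarrow> q \<in> carrier (free_algebra X) \<Longrightarrow>
    UEA_class X (p + q) = UEA_class X p \<oplus>\<^bsub>gl_UEA X\<^esub> UEA_class X q"
  using ring_hom_add[OF UEA_class_hom, of p X q] by simp

lemma UEA_class_mult:
  "p \<in> carrier (free_algebra X) \<Longrightarrow> q \<in> carrier (free_algebra X) \<Longrightarrow>
    UEA_class X (p * q) = UEA_class X p \<otimes>\<^bsub>gl_UEA X\<^esub> UEA_class X q"
  using ring_hom_mult[OF UEA_class_hom, of p X q] by simp

lemma UEA_class_closed:
  "p \<in> carrier (free_algebra X) \<Longrightarrow> UEA_class X p \<in> carrier (gl_UEA X)"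
  using ring_hom_closed[OF UEA_class_hom] .

lemma UEA_class_uminus:
  assumes "p \<in> carrier (free_algebra X)"
  shows "UEA_class X (- p) = \<ominus>\<^bsub>gl_UEA X\<^esub> UEA_class X p"
proof -
  interpret ring_hom_ring "free_algebra X" "gl_UEA X" "UEA_class X"
    by (rule ring_hom_ringI2[OF ring_free_algebra ring_gl_UEA UEA_class_hom])
  show ?thesis using hom_a_inv[OF assms] by (simp add: a_inv_free_algebra assms)
qed

lemma UEA_class_diff:
  assumes "p \<in> carrier (free_algebra X)" "q \<in> carrier (free_algebra X)"
  shows "UEA_class X (p - q) = UEA_class X p \<ominus>\<^bsub>gl_UEA X\<^esub> UEA_class X q"
  using assms UEA_class_add[of p X "- q"]
  by (simp add: UEA_class_uminus a_minus_def free_algebra_closed)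

lemma carrier_gl_UEA: "carrier (gl_UEA X) = UEA_class X ` carrier (free_algebra X)"
  by (auto simp: gl_UEA_def FactRing_def A_RCOSETS_def' UEA_class_def)

lemma UEA_class_eq: "UEA_class X p = {h + p |h. h \<in> gl_ideal X}"
  by (auto simp: UEA_class_def a_r_coset_def')

lemma UEA_class_self: "p \<in> UEA_class X p"
  unfolding UEA_class_eq
  using additive_subgroup.zero_closed[OF ideal.axioms(1)[OF ideal_gl_ideal, of X]]
  by (auto intro: exI[of _ 0])

lemma gl_ideal_carrier: "gl_ideal X \<subseteq> carrier (free_algebra X)"
  using additive_subgroup.a_subset[OF ideal.axioms(1)[OF ideal_gl_ideal]] .

lemma gl_ideal_zero: "0 \<in> gl_ideal X"
  using additive_subgroup.zero_closed[OF ideal.axioms(1)[OF ideal_gl_ideal, of X]] by simp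

lemma gl_ideal_add: "p \<in> gl_ideal X \<Longrightarrow> q \<in> gl_ideal X \<Longrightarrow> p + q \<in> gl_ideal X"
  using additive_subgroup.a_closed[OF ideal.axioms(1)[OF ideal_gl_ideal, of X], of p q] by simp

lemma gl_ideal_mult:
  assumes "p \<in> gl_ideal X" "q \<in> carrier (free_algebra X)"
  shows "q * p \<in> gl_ideal X" "p * q \<in> gl_ideal X"
  using ideal.I_l_closed[OF ideal_gl_ideal assms] ideal.I_r_closed[OF ideal_gl_ideal assms]
  by simp_all

lemma gl_ideal_uminus: "p \<in> gl_ideal X \<Longrightarrow> - p \<in> gl_ideal X"
  using gl_ideal_mult(1)[of p X "- 1"] by (simp add: free_algebra_closed)

lemma UEA_class_ideal:
  assumes "p \<in> gl_ideal X"
  shows "UEA_class X p = \<zero>\<^bsub>gl_UEA X\<^esub>"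
proof -
  have "g \<in> UEA_class X p" if "g \<in> gl_ideal X" for g
    unfolding UEA_class_eq mem_Collect_eq
    using gl_ideal_add[OF that gl_ideal_uminus[OF assms]]
    by (intro exI[of _ "g + - p"] conjI) simp_all
  moreover have "g \<in> gl_ideal X" if "g \<in> UEA_class X p" for g
    using that gl_ideal_add[OF _ assms] unfolding UEA_class_eq by blast
  moreover have "\<zero>\<^bsub>gl_UEA X\<^esub> = gl_ideal X"
    by (simp add: gl_UEA_def FactRing_def)
  ultimately show ?thesis by blast
qed

text \<open>The part of the larger ideal inside the smaller free algebra is an ideal there. It
  contains the smaller relations, whose form does not depend on the symbol set.\<close>

lemma gl_ideal_mono: "X \<subseteq> Y \<Longrightarrow> gl_ideal X \<subseteq> gl_ideal Y"
proof -
  assume XY: "X \<subseteq> Y"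
  have sub: "carrier (free_algebra X) \<subseteq> carrier (free_algebra Y)"
    using XY by (auto simp: free_algebra_def)
  interpret X: ring "free_algebra X" by (rule ring_free_algebra)
  let ?I = "gl_ideal Y \<inter> carrier (free_algebra X)"
  have "ideal ?I (free_algebra X)"
  proof (rule idealI[OF ring_free_algebra])
    show "subgroup ?I (add_monoid (free_algebra X))"
    proof
      fix p assume p: "p \<in> ?I"
      then have "inv\<^bsub>add_monoid (free_algebra X)\<^esub> p = - p"
        using a_inv_free_algebra[of p X] by (simp only: a_inv_def Int_iff)
      with p show "inv\<^bsub>add_monoid (free_algebra X)\<^esub> p \<in> ?I"
        by (simp add: gl_ideal_uminus free_algebra_closed)
    qed (simp_all add: free_algebra_closed gl_ideal_zero gl_ideal_add)
  qed (use sub in \<open>simp_all add: free_algebra_closed gl_ideal_mult subset_iff\<close>)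
  moreover have "gl_relations X \<subseteq> ?I"
    using gl_relations_closed gl_relations_in_ideal[of Y] XY by (fastforce simp: gl_relations_def)
  ultimately show ?thesis
    unfolding gl_ideal_def[of X] using X.genideal_minimal by blast
qed

text \<open>The larger ideal absorbs the smaller one, so on representatives the canonical map is the
  identity.\<close>

lemma UEA_embed_class:
  assumes "p \<in> carrier (free_algebra (proper_symbols n))"
  shows "UEA_embed m0 m1 n (UEA_class (proper_symbols n) p) = UEA_class (all_symbols m0 m1 n) p"
proof -
  let ?X = "all_symbols m0 m1 n"
  have sub: "gl_ideal (proper_symbols n) \<subseteq> gl_ideal ?X"
    by (rule gl_ideal_mono) (auto simp: all_symbols_def)
  have "g + (h + p) \<in> UEA_class ?X p" if "g \<in> gl_ideal ?X" "h \<in> gl_ideal (proper_symbols n)" for g h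
    unfolding UEA_class_eq mem_Collect_eq
    using gl_ideal_add[OF that(1)] that(2) sub by (intro exI[of _ "g + h"]) (auto simp: add.assoc)
  then show ?thesis
    unfolding UEA_embed_def set_add_def'
    using UEA_class_self[of p "proper_symbols n"] by (fastforce simp: UEA_class_eq)
qed

section \<open>Representations of the Lie superalgebra\<close>

text \<open>Modules over the Lie superalgebra on the symbols \<open>X\<close>. The supercommutator
  relation is solved for one product; the contraction at \<open>a = d\<close> has the same sign as
  the exchanged product, so both stand under one scalar.\<close>

locale gl_rep = vector_space scale
  for scale :: "complex \<Rightarrow> 'v::ab_group_add \<Rightarrow> 'v" +
  fixes X :: "symbol set" and \<rho> :: "symbol \<Rightarrow> symbol \<Rightarrow> 'v \<Rightarrow> 'v"
  assumes rho_add: "a \<in> X \<Longrightarrow> b \<in> X \<Longrightarrow> \<rho> a b (x + y) = \<rho> a b x + \<rho> a b y"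
    and rho_scale: "a \<in> X \<Longrightarrow> b \<in> X \<Longrightarrow> \<rho> a b (scale r x) = scale r (\<rho> a b x)"
    and rho_comm: "a \<in> X \<Longrightarrow> b \<in> X \<Longrightarrow> c \<in> X \<Longrightarrow> d \<in> X \<Longrightarrow>
      \<rho> a b (\<rho> c d x) =
        scale ((- 1) ^ ((parity a + parity b) * (parity c + parity d)))
          (\<rho> c d (\<rho> a b x) - (if a = d then \<rho> c b x else 0)) + (if b = c then \<rho> a d x else 0)"
begin

abbreviation act :: "gl_free \<Rightarrow> 'v \<Rightarrow> 'v" where "act \<equiv> free_act scale \<rho>"

definition word_act :: "(symbol \<times> symbol) list \<Rightarrow> 'v \<Rightarrow> 'v" where
  "word_act w = foldr (\<lambda>(a, b). \<rho> a b) w"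

lemma word_act_simps [simp]:
  "word_act [] x = x" "word_act ((a, b) # w) x = \<rho> a b (word_act w x)"
  "word_act (v @ w) x = word_act v (word_act w x)"
  by (simp_all add: word_act_def)

lemma word_act_linear:
  assumes "set w \<subseteq> X \<times> X"
  shows "word_act w (x + y) = word_act w x + word_act w y"
    and "word_act w (scale c x) = scale c (word_act w x)"
  using assms by (induction w) (auto simp: rho_add rho_scale)

lemma act_superset:
  assumes "finite A" "Poly_Mapping.keys p \<subseteq> A"
  shows "act p x = (\<Sum>w\<in>A. scale (Poly_Mapping.lookup p w) (word_act (letters w) x))"
  unfolding free_act_def word_act_def using assms
  by (intro sum.mono_neutral_left) (auto simp: in_keys_iff)

lemma act_0 [simp]: "act 0 x = 0"
  by (simp add: free_act_def)

lemma act_single: "act (Poly_Mapping.single w c) x = scale c (word_act (letters w) x)"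
  by (subst act_superset[of "{w}"]) auto

lemma act_monomial: "act (gl_monomial w) x = word_act w x"
  by (simp add: gl_monomial_def act_single)

lemma act_scalar: "act (gl_scalar c) x = scale c x"
  by (simp add: gl_scalar_def act_single zero_gl_word_def)

lemma act_add: "act (p + q) x = act p x + act q x"
proof -
  let ?A = "Poly_Mapping.keys p \<union> Poly_Mapping.keys q"
  have "Poly_Mapping.keys (p + q) \<subseteq> ?A" by (rule keys_add)
  then show ?thesis
    by (simp add: act_superset[of ?A] lookup_add scale_left_distrib sum.distrib)
qed

lemma act_uminus: "act (- p) x = - act p x"
  using act_add[of p "- p" x] by (metis add.right_inverse act_0 add_eq_0_iff)

lemma act_diff: "act (p - q) x = act p x - act q x"
  using act_add[of p "- q" x] by (simp add: act_uminus)

text \<open>Membership in the free algebra over \<open>X\<close> matters, because the operators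
  \<open>\<rho> a b\<close> are assumed linear only for symbols of \<open>X\<close>.\<close>

lemma act_linear:
  assumes "p \<in> carrier (free_algebra X)"
  shows "act p (x + y) = act p x + act p y \<and> act p (scale c x) = scale c (act p x)"
  using assms unfolding carrier_free_algebra mem_Collect_eq
proof (induction p rule: keys_induct)
  case (single w d)
  then show ?case
    by (simp add: act_single words_def word_act_linear scale_right_distrib mult.commute)
qed (simp_all add: act_add scale_right_distrib algebra_simps)

lemmas act_add_right = act_linear[THEN conjunct1] and act_scale_right = act_linear[THEN conjunct2]

lemma act_zero_right: "p \<in> carrier (free_algebra X) \<Longrightarrow> act p 0 = 0"
  using act_scale_right[of p 0 0] by simp

lemma act_mult:
  assumes "p \<in> carrier (free_algebra X)" "q \<in> carrier (free_algebra X)"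
  shows "act (p * q) x = act p (act q x)"
  using assms(1) unfolding carrier_free_algebra mem_Collect_eq
proof (induction p rule: keys_induct)
  case (single w c)
  show ?case
    using assms(2) unfolding carrier_free_algebra mem_Collect_eq
  proof (induction q rule: keys_induct)
    case zero
    show ?case using single by (simp add: act_zero_right free_algebra_closed)
  next
    case (single v d)
    then show ?case using \<open>w \<in> words X\<close>
      by (simp add: mult_single act_single plus_gl_word_def words_def word_act_linear)
  next
    case (add p q)
    with single show ?case
      by (simp add: algebra_simps act_add act_add_right free_algebra_closed)
  qed
qed (simp_all add: act_add distrib_right)

lemma act_gl_relations:
  assumes "r \<in> gl_relations X"
  shows "act r x = 0"
proof -
  obtain a b c d where abcd: "a \<in> X" "b \<in> X" "c \<in> X" "d \<in> X"
    and r: "r = gl_gen a b * gl_gen c d - super_sign (a, b) (c, d) * (gl_gen c d * gl_gen a b)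
      - gl_bracket (a, b) (c, d)"
    using assms by (auto simp: gl_relations_def)
  have closed: "gl_gen y z \<in> carrier (free_algebra X)" if "y \<in> X" "z \<in> X" for y z
    using that by (intro gl_monomial_closed) auto
  show ?thesis
    unfolding r gl_bracket_def prod.case super_sign_eq act_diff
    by (simp add: abcd closed act_mult act_monomial act_scalar rho_comm[of a b c d]
        gl_scalar_closed free_algebra_closed scale_right_diff_distrib if_distrib[of "\<lambda>p. act p x"])
qed

text \<open>The elements acting as zero on the whole module form a two-sided ideal containing the
  relations. This makes the action well defined on cosets.\<close>

lemma act_gl_ideal:
  assumes "p \<in> gl_ideal X"
  shows "act p x = 0"
proof -
  let ?R = "free_algebra X"
  let ?K = "{p \<in> carrier ?R. \<forall>x. act p x = 0}"
  interpret R: ring ?R by (rule ring_free_algebra)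
  have "ideal ?K ?R"
  proof (rule idealI[OF ring_free_algebra])
    show "subgroup ?K (add_monoid ?R)"
    proof
      fix p assume p: "p \<in> ?K"
      then have "inv\<^bsub>add_monoid ?R\<^esub> p = - p"
        using a_inv_free_algebra[of p X] by (simp only: a_inv_def mem_Collect_eq)
      with p show "inv\<^bsub>add_monoid ?R\<^esub> p \<in> ?K"
        by (simp add: free_algebra_closed act_uminus)
    qed (auto simp: free_algebra_closed act_add)
  qed (auto simp: free_algebra_closed act_mult act_zero_right)
  moreover have "gl_relations X \<subseteq> ?K"
    using gl_relations_closed act_gl_relations by auto
  ultimately show ?thesis
    using assms R.genideal_minimal[of ?K "gl_relations X"] unfolding gl_ideal_def by blast
qed

lemma act_UEA_class:
  assumes "q \<in> UEA_class X p"
  shows "act q x = act p x"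
  using assms by (auto simp: UEA_class_eq act_add act_gl_ideal)

section \<open>Annihilators of vectors in the enveloping algebra\<close>

definition annihilator :: "'v \<Rightarrow> gl_free set set" where
  "annihilator x = UEA_class X ` {p \<in> carrier (free_algebra X). act p x = 0}"

lemma UEA_class_annihilator:
  assumes "p \<in> carrier (free_algebra X)"
  shows "UEA_class X p \<in> annihilator x \<longleftrightarrow> act p x = 0"
proof
  assume "UEA_class X p \<in> annihilator x"
  then obtain q where "UEA_class X p = UEA_class X q" "act q x = 0"
    by (auto simp: annihilator_def)
  then show "act p x = 0"
    using act_UEA_class[of p q x] UEA_class_self[of p X] by simp
qed (auto simp: annihilator_def assms)

text \<open>Killing a fixed vector is preserved by multiplication from the left, which matches the
  one-sided definition of \<open>Irr\<close>: the annihilator contains \<open>Irr\<close> as soon as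
  it contains the irregular products.\<close>

lemma left_ideal_annihilator: "left_ideal (annihilator x) (gl_UEA X)"
proof -
  let ?U = "gl_UEA X"
  interpret U: ring ?U by (rule ring_gl_UEA)
  have "subgroup (annihilator x) (add_monoid ?U)"
  proof (rule group.subgroupI[OF U.a_group])
    show "annihilator x \<subseteq> carrier (add_monoid ?U)"
      by (auto simp: annihilator_def UEA_class_closed)
    show "annihilator x \<noteq> {}"
      using UEA_class_annihilator[of 0 x] by (auto simp: free_algebra_closed)
  next
    fix u assume "u \<in> annihilator x"
    then obtain p where "u = UEA_class X p" "p \<in> carrier (free_algebra X)" "act p x = 0"
      by (auto simp: annihilator_def)
    then show "inv\<^bsub>add_monoid ?U\<^esub> u \<in> annihilator x"
      using UEA_class_uminus[of p X] UEA_class_annihilator[of "- p" x]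
      by (simp add: free_algebra_closed act_uminus a_inv_def)
  next
    fix u v assume "u \<in> annihilator x" "v \<in> annihilator x"
    then obtain p q where "u = UEA_class X p" "p \<in> carrier (free_algebra X)" "act p x = 0"
      "v = UEA_class X q" "q \<in> carrier (free_algebra X)" "act q x = 0"
      by (auto simp: annihilator_def)
    then show "u \<otimes>\<^bsub>add_monoid ?U\<^esub> v \<in> annihilator x"
      using UEA_class_add[of p X q] UEA_class_annihilator[of "p + q" x]
      by (simp add: free_algebra_closed act_add)
  qed
  moreover have "u \<otimes>\<^bsub>?U\<^esub> v \<in> annihilator x" if "u \<in> carrier ?U" "v \<in> annihilator x" for u v
  proof -
    from that obtain p q where "u = UEA_class X p" "p \<in> carrier (free_algebra X)"
      "v = UEA_class X q" "q \<in> carrier (free_algebra X)" "act q x = 0"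
      by (auto simp: annihilator_def carrier_gl_UEA)
    then show ?thesis
      using UEA_class_mult[of p X q] UEA_class_annihilator[of "p * q" x]
      by (simp add: free_algebra_closed act_mult act_zero_right)
  qed
  ultimately show ?thesis by (simp add: left_ideal_def additive_subgroup_def)
qed

text \<open>All representatives of a coset act alike, so the arbitrary choice inside
  \<open>UEA_act\<close> does not affect the result.\<close>

lemma UEA_act_annihilator:
  assumes "u \<in> annihilator x"
  shows "UEA_act scale \<rho> u x = 0"
proof -
  obtain p where u: "u = UEA_class X p" and p: "act p x = 0"
    using assms by (auto simp: annihilator_def)
  have "(SOME q. q \<in> u) \<in> UEA_class X p"
    unfolding u using UEA_class_self by (rule someI)
  then show ?thesis
    using act_UEA_class[of _ p x] p by (simp add: UEA_act_def)
qed

end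

lemma left_genideal_subset: "left_ideal I R \<Longrightarrow> S \<subseteq> I \<Longrightarrow> left_genideal R S \<subseteq> I"
  by (auto simp: left_genideal_def)

section \<open>The projection onto the proper part\<close>

lemma left_genideal_closed:
  shows "\<zero>\<^bsub>R\<^esub> \<in> left_genideal R S"
    and "u \<in> left_genideal R S \<Longrightarrow> v \<in> left_genideal R S \<Longrightarrow> u \<oplus>\<^bsub>R\<^esub> v \<in> left_genideal R S"
    and "x \<in> carrier R \<Longrightarrow> u \<in> left_genideal R S \<Longrightarrow> x \<otimes>\<^bsub>R\<^esub> u \<in> left_genideal R S"
  by (auto simp: left_genideal_def left_ideal_def additive_subgroup.zero_closed additive_subgroup.a_closed)

section \<open>Normal forms modulo irregular products\<close>

locale virtual_algebra =
  fixes m0 m1 n :: nat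
begin

abbreviation X :: "symbol set" where "X \<equiv> all_symbols m0 m1 n"
abbreviation V :: "symbol set" where "V \<equiv> virtual_symbols m0 m1"
abbreviation L :: "symbol set" where "L \<equiv> proper_symbols n"

lemma symbols:
  shows "X = V \<union> L" and "V \<inter> L = {}"
  by (auto simp: all_symbols_def virtual_symbols_def proper_symbols_def)

text \<open>The preimage of \<open>Irr\<close> in the free algebra, so that reordering can be done
  on words rather than on cosets.\<close>

definition irr_free :: "gl_free set" where
  "irr_free = {p \<in> carrier (free_algebra X). UEA_class X p \<in> Irr m0 m1 n}"

lemma irr_free_add: "p \<in> irr_free \<Longrightarrow> q \<in> irr_free \<Longrightarrow> p + q \<in> irr_free"
  by (auto simp: irr_free_def Irr_def Let_def UEA_class_add free_algebra_closed left_genideal_closed)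

lemma irr_free_mult: "p \<in> carrier (free_algebra X) \<Longrightarrow> q \<in> irr_free \<Longrightarrow> p * q \<in> irr_free"
  by (auto simp: irr_free_def Irr_def Let_def UEA_class_mult UEA_class_closed
      free_algebra_closed left_genideal_closed)

lemma gl_ideal_irr_free: "p \<in> gl_ideal X \<Longrightarrow> p \<in> irr_free"
  using gl_ideal_carrier
  by (auto simp: irr_free_def Irr_def Let_def UEA_class_ideal left_genideal_closed)

lemma irr_free_gen:
  assumes "a \<in> X" "b \<in> V"
  shows "gl_gen a b \<in> irr_free"
proof -
  \<comment> \<open>A single factor is irregular at index 0: \<open>b\<close> is annihilated once
    and nothing has been created before.\<close>
  have "{j. j = 0 \<and> snd ([(a, b)] ! j) = b} = {0}" by auto
  then have "irregular m0 m1 [(a, b)]"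
    unfolding irregular_def using assms(2) by (intro exI[of _ 0] conjI bexI[of _ b]) simp_all
  moreover have 1: "set [(a, b)] \<subseteq> X \<times> X" using assms symbols by auto
  ultimately have "UEA_class X (gl_gen a b) \<in> Irr m0 m1 n"
    unfolding Irr_def Let_def left_genideal_def by blast
  then show ?thesis using gl_monomial_closed[OF 1] by (simp add: irr_free_def)
qed

text \<open>Creators of virtual symbols stand on the left, a proper word on the right. The degree is
  an integer because it can become negative, in which case there are no normal words.\<close>

definition normal_words :: "int \<Rightarrow> gl_word set" where
  "normal_words d =
    {Word (u @ v) | u v. set u \<subseteq> V \<times> L \<and> set v \<subseteq> L \<times> L \<and> int (length u) = d}"

definition normal_span :: "int \<Rightarrow> gl_free set" where
  "normal_span d = {q + k | q k. Poly_Mapping.keys q \<subseteq> normal_words d \<and> k \<in> irr_free}"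

lemma normal_span_add:
  assumes "p \<in> normal_span d" "p' \<in> normal_span d"
  shows "p + p' \<in> normal_span d"
proof -
  obtain q k q' k' where p: "p = q + k" "p' = q' + k'"
    and q: "Poly_Mapping.keys q \<subseteq> normal_words d" "Poly_Mapping.keys q' \<subseteq> normal_words d"
    and k: "k \<in> irr_free" "k' \<in> irr_free"
    using assms by (auto simp: normal_span_def)
  have "p + p' = (q + q') + (k + k')" by (simp add: p)
  moreover have "Poly_Mapping.keys (q + q') \<subseteq> normal_words d" using keys_add[of q q'] q by auto
  ultimately show ?thesis using irr_free_add[OF k] by (auto simp: normal_span_def)
qed

lemma irr_free_normal_span: "irr_free \<subseteq> normal_span d"
  using keys_zero by (fastforce simp: normal_span_def intro: exI[of _ 0])

lemma normal_span_negative: "d < 0 \<Longrightarrow> normal_span d = irr_free"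
  by (auto simp: normal_span_def normal_words_def)

lemma normal_span_scalar:
  assumes "p \<in> normal_span d"
  shows "gl_scalar c * p \<in> normal_span d"
proof -
  obtain q k where p: "p = q + k"
    and q: "Poly_Mapping.keys q \<subseteq> normal_words d" and k: "k \<in> irr_free"
    using assms by (auto simp: normal_span_def)
  have "Poly_Mapping.keys (gl_scalar c * q) \<subseteq> normal_words d"
    using keys_mult[of "gl_scalar c" q] q by (auto simp: gl_scalar_def split: if_splits)
  then show ?thesis
    using irr_free_mult[OF gl_scalar_closed k] by (auto simp: normal_span_def p distrib_left)
qed

lemma normal_span_lower:
  assumes "p \<in> normal_span d" "a \<in> V" "b \<in> L"
  shows "gl_gen a b * p \<in> normal_span (d + 1)"
proof -
  obtain q k where p: "p = q + k"
    and q: "Poly_Mapping.keys q \<subseteq> normal_words d" and k: "k \<in> irr_free"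
    using assms by (auto simp: normal_span_def)
  have "Word [(a, b)] + w \<in> normal_words (d + 1)" if w: "w \<in> normal_words d" for w
  proof -
    obtain u v where "w = Word (u @ v)" "set u \<subseteq> V \<times> L" "set v \<subseteq> L \<times> L" "int (length u) = d"
      using w by (auto simp: normal_words_def)
    then have "Word [(a, b)] + w = Word (((a, b) # u) @ v) \<and> set ((a, b) # u) \<subseteq> V \<times> L
        \<and> set v \<subseteq> L \<times> L \<and> int (length ((a, b) # u)) = d + 1"
      using assms by (auto simp: plus_gl_word_def)
    then show ?thesis unfolding normal_words_def by blast
  qed
  then have "Poly_Mapping.keys (gl_gen a b * q) \<subseteq> normal_words (d + 1)"
    using keys_mult[of "gl_gen a b" q] q by (auto simp: gl_monomial_def)
  moreover have "gl_gen a b \<in> carrier (free_algebra X)"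
    using assms symbols by (intro gl_monomial_closed) auto
  ultimately show ?thesis
    using irr_free_mult[OF _ k] by (auto simp: normal_span_def p distrib_left)
qed

lemma gl_gen_times: "gl_gen a b * gl_monomial w = gl_monomial ((a, b) # w)"
  by (simp add: gl_monomial_def mult_single plus_gl_word_def)

text \<open>The supercommutator relation, multiplied by \<open>p\<close> on the right, lies in the
  ideal and hence in every \<open>normal_span\<close>. So two factors may be exchanged once the
  exchanged product and the two contractions are under control.\<close>

lemma normal_span_swap:
  assumes X: "a \<in> X" "b \<in> X" "c \<in> X" "d \<in> X" and p: "p \<in> carrier (free_algebra X)"
    and 1: "gl_gen c d * (gl_gen a b * p) \<in> normal_span e"
    and 2: "b = c \<Longrightarrow> gl_gen a d * p \<in> normal_span e"
    and 3: "a = d \<Longrightarrow> gl_gen c b * p \<in> normal_span e"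
  shows "gl_gen a b * (gl_gen c d * p) \<in> normal_span e"
proof -
  let ?s = "(- 1) ^ ((parity a + parity b) * (parity c + parity d)) :: complex"
  let ?r = "gl_gen a b * gl_gen c d - gl_scalar ?s * (gl_gen c d * gl_gen a b)
        - gl_bracket (a, b) (c, d)"
  have "?r \<in> gl_relations X"
    unfolding gl_relations_def super_sign_eq[symmetric] using X by blast
  then have A: "?r * p \<in> normal_span e"
    using gl_relations_in_ideal gl_ideal_mult(2)[OF _ p] gl_ideal_irr_free irr_free_normal_span by blast
  have zero: "0 \<in> normal_span e"
    using irr_free_normal_span gl_ideal_irr_free[OF gl_ideal_zero] by blast
  have B: "(if b = c then gl_gen a d else 0) * p \<in> normal_span e"
    using 2 zero by simp
  have "(if a = d then gl_gen c b else 0) * p \<in> normal_span e"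
    using 3 zero by simp
  then have C: "gl_scalar (- ?s) * ((if a = d then gl_gen c b else 0) * p) \<in> normal_span e"
    by (rule normal_span_scalar)
  define x y where "x = gl_gen a b" and "y = gl_gen c d"
  have minus: "gl_scalar (- ?s) = - gl_scalar ?s" by (simp add: gl_scalar_def single_uminus)
  have "gl_gen a b * (gl_gen c d * p) = ?r * p
      + (gl_scalar ?s * (gl_gen c d * (gl_gen a b * p))
      + ((if b = c then gl_gen a d else 0) * p + gl_scalar (- ?s) * ((if a = d then gl_gen c b else 0) * p)))"
    unfolding gl_bracket_def super_sign_eq minus prod.case left_diff_distrib mult.assoc
      x_def[symmetric] y_def[symmetric] by simp
  with normal_span_add[OF A normal_span_add[OF normal_span_scalar[OF 1, of ?s] normal_span_add[OF B C]]]
  show ?thesis by (simp only:)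
qed

text \<open>Below, \<open>normal_span (- 1)\<close> serves as another name for \<^const>\<open>irr_free\<close>, so that the previous
  lemma applies to both.\<close>

lemma raising_times_proper:
  assumes "a \<in> X" "b \<in> V" "set v \<subseteq> L \<times> L"
  shows "gl_monomial ((a, b) # v) \<in> irr_free"
  using assms
proof (induction v arbitrary: a)
  case Nil
  then show ?case by (simp add: irr_free_gen)
next
  case (Cons y v)
  obtain c d where y: "y = (c, d)" by force
  have cd: "c \<in> L" "d \<in> L" "c \<in> X" "d \<in> X" "b \<in> X" "b \<noteq> c" using Cons.prems y symbols by auto
  have v: "gl_monomial v \<in> carrier (free_algebra X)"
    using Cons.prems symbols by (intro gl_monomial_closed) auto
  have "gl_gen a b * (gl_gen c d * gl_monomial v) \<in> normal_span (- 1)"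
  proof (rule normal_span_swap)
    have "gl_gen c d \<in> carrier (free_algebra X)" using cd by (intro gl_monomial_closed) auto
    moreover have "gl_gen a b * gl_monomial v \<in> irr_free"
      using Cons by (simp add: gl_gen_times)
    ultimately show "gl_gen c d * (gl_gen a b * gl_monomial v) \<in> normal_span (- 1)"
      by (simp add: normal_span_negative irr_free_mult)
    \<comment> \<open>The only contraction that can occur, at \<open>a = d\<close>, leaves
      \<open>gl_gen c b\<close>, which again annihilates \<open>b\<close>; the induction hypothesis
      holds for every first symbol.\<close>
    show "gl_gen c b * gl_monomial v \<in> normal_span (- 1)"
      using Cons.IH[of c] Cons.prems cd by (simp add: normal_span_negative gl_gen_times)
  qed (use Cons.prems cd v in auto)
  then show ?case by (simp add: normal_span_negative gl_gen_times y)
qed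

text \<open>The net number of virtual symbols created by a factor. Contracting two factors at a
  common symbol cancels the contributions of that symbol, so the relations preserve the total
  degree.\<close>

definition vdeg :: "symbol \<times> symbol \<Rightarrow> int" where
  "vdeg = (\<lambda>(a, b). of_bool (a \<in> V) - of_bool (b \<in> V))"

text \<open>The new factor is moved to the right through the creators. Each exchange leaves
  contractions of one degree more in front of a block shorter by one, so the total degree is
  unchanged and the induction hypothesis applies.\<close>

lemma gen_times_normal_word:
  assumes "a \<in> X" "b \<in> X" "set u \<subseteq> V \<times> L" "set v \<subseteq> L \<times> L"
  shows "gl_monomial ((a, b) # u @ v) \<in> normal_span (vdeg (a, b) + int (length u))"
  using assms
proof (induction u arbitrary: a b)
  case Nil
  \<comment> \<open>With no creators left, the factor annihilates a virtual symbol and falls into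
    the irregular part, or is itself a creator, or joins the proper word.\<close>
  consider "b \<in> V" | "a \<in> V" "b \<in> L" | "a \<in> L" "b \<in> L" using Nil symbols(1) by auto
  then show ?case
  proof cases
    case 1
    then show ?thesis using raising_times_proper[of a b v] Nil irr_free_normal_span by auto
  next
    case 2
    then have "vdeg (a, b) = 1" using symbols(2) by (auto simp: vdeg_def)
    moreover have "Word ([(a, b)] @ v) \<in> normal_words 1"
      using 2 Nil unfolding normal_words_def mem_Collect_eq
      by (intro exI[of _ "[(a, b)]"] exI[of _ v]) auto
    ultimately show ?thesis
      using gl_ideal_irr_free[OF gl_ideal_zero] by (force simp: normal_span_def gl_monomial_def)
  next
    case 3
    then have "vdeg (a, b) = 0" using symbols(2) by (auto simp: vdeg_def)
    moreover have "Word ([] @ (a, b) # v) \<in> normal_words 0"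
      using 3 Nil unfolding normal_words_def mem_Collect_eq
      by (intro exI[of _ "[]"] exI[of _ "(a, b) # v"]) auto
    ultimately show ?thesis
      using gl_ideal_irr_free[OF gl_ideal_zero] by (force simp: normal_span_def gl_monomial_def)
  qed
next
  case (Cons y u)
  obtain c d where y: "y = (c, d)" by force
  have cd: "c \<in> V" "d \<in> L" "c \<in> X" "d \<in> X" using Cons.prems y symbols(1) by auto
  have w: "gl_monomial (u @ v) \<in> carrier (free_algebra X)"
    using Cons.prems symbols(1) by (intro gl_monomial_closed) auto
  let ?e = "vdeg (a, b) + int (length (y # u))"
  have deg: "vdeg (c, d) = 1" using cd symbols(2) by (auto simp: vdeg_def)
  have IH: "gl_gen a' b' * gl_monomial (u @ v) \<in> normal_span ?e"
    if "a' \<in> X" "b' \<in> X" "vdeg (a', b') = vdeg (a, b) + 1" for a' b'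
    using Cons.IH[of a' b'] Cons.prems that by (simp add: gl_gen_times add_ac)
  have "gl_gen a b * (gl_gen c d * gl_monomial (u @ v)) \<in> normal_span ?e"
  proof (rule normal_span_swap)
    have "gl_gen a b * gl_monomial (u @ v) \<in> normal_span (vdeg (a, b) + int (length u))"
      using Cons by (simp add: gl_gen_times)
    from normal_span_lower[OF this cd(1,2)]
    show "gl_gen c d * (gl_gen a b * gl_monomial (u @ v)) \<in> normal_span ?e"
      by (simp add: add_ac)
    show "gl_gen a d * gl_monomial (u @ v) \<in> normal_span ?e" if "b = c"
      using deg cd Cons.prems that by (intro IH) (auto simp: vdeg_def)
    show "gl_gen c b * gl_monomial (u @ v) \<in> normal_span ?e" if "a = d"
      using deg cd Cons.prems that by (intro IH) (auto simp: vdeg_def)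
  qed (use Cons.prems cd w in auto)
  then show ?case by (simp add: gl_gen_times y)
qed

lemma gen_times_normal_span:
  assumes "a \<in> X" "b \<in> X" "p \<in> normal_span d"
  shows "gl_gen a b * p \<in> normal_span (vdeg (a, b) + d)"
proof -
  obtain q k where p: "p = q + k"
    and q: "Poly_Mapping.keys q \<subseteq> normal_words d" and k: "k \<in> irr_free"
    using assms by (auto simp: normal_span_def)
  have "gl_gen a b * q \<in> normal_span (vdeg (a, b) + d)"
    using q
  proof (induction q rule: keys_induct)
    case zero
    then show ?case using irr_free_normal_span gl_ideal_irr_free[OF gl_ideal_zero] by auto
  next
    case (single w c)
    then obtain u v where w: "w = Word (u @ v)" and uv: "set u \<subseteq> V \<times> L" "set v \<subseteq> L \<times> L" "int (length u) = d"
      by (auto simp: normal_words_def)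
    have "gl_gen a b * Poly_Mapping.single w c = gl_scalar c * gl_monomial ((a, b) # u @ v)"
      by (simp add: gl_monomial_def mult_single plus_gl_word_def zero_gl_word_def gl_scalar_def w)
    then show ?case
      using gen_times_normal_word[OF assms(1,2) uv(1,2)] uv(3) normal_span_scalar by simp
  next
    case (add p q)
    then show ?case by (simp add: distrib_left normal_span_add)
  qed
  moreover have "gl_gen a b * k \<in> normal_span (vdeg (a, b) + d)"
    using assms k irr_free_mult irr_free_normal_span gl_monomial_closed[of "[(a, b)]" X] by auto
  ultimately show ?thesis by (simp add: p distrib_left normal_span_add)
qed

lemma monomial_normal_span:
  assumes "set w \<subseteq> X \<times> X"
  shows "gl_monomial w \<in> normal_span (\<Sum>x\<leftarrow>w. vdeg x)"
  using assms
proof (induction w)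
  case Nil
  have "Word ([] @ []) \<in> normal_words 0"
    unfolding normal_words_def mem_Collect_eq by (intro exI conjI) auto
  then show ?case
    using gl_ideal_irr_free[OF gl_ideal_zero] by (force simp: normal_span_def gl_monomial_def)
next
  case (Cons x w)
  then show ?case
    using gen_times_normal_span[of "fst x" "snd x" "gl_monomial w" "\<Sum>x\<leftarrow>w. vdeg x"]
    by (cases x) (simp add: gl_gen_times)
qed

text \<open>In degree zero a normal word has no creators and so is a word in proper symbols. The
  normal part therefore has the property by which \<open>virt_proj\<close> chooses, and the
  conclusion holds for whatever value is chosen.\<close>

lemma virt_proj_monomial:
  assumes "set w \<subseteq> X \<times> X" "(\<Sum>x\<leftarrow>w. vdeg x) = 0"
  obtains p where "p \<in> carrier (free_algebra L)"
    and "virt_proj m0 m1 n (UEA_class X (gl_monomial w)) = UEA_class L p"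
    and "UEA_class X (gl_monomial w - p) \<in> Irr m0 m1 n"
proof -
  let ?Q = "\<lambda>u. u \<in> carrier (gl_UEA L) \<and>
        UEA_class X (gl_monomial w) \<ominus>\<^bsub>gl_UEA X\<^esub> UEA_embed m0 m1 n u \<in> Irr m0 m1 n"
  have LX: "carrier (free_algebra L) \<subseteq> carrier (free_algebra X)"
    using symbols(1) by (auto simp: free_algebra_def)
  have diff: "UEA_class X (gl_monomial w) \<ominus>\<^bsub>gl_UEA X\<^esub> UEA_embed m0 m1 n (UEA_class L p)
      = UEA_class X (gl_monomial w - p)" if "p \<in> carrier (free_algebra L)" for p
    using that LX gl_monomial_closed[OF assms(1)] by (auto simp: UEA_embed_class UEA_class_diff)
  obtain q k where qk: "gl_monomial w = q + k"
    and q: "Poly_Mapping.keys q \<subseteq> normal_words 0" and k: "k \<in> irr_free"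
    using monomial_normal_span[OF assms(1)] assms(2) by (auto simp: normal_span_def)
  have "normal_words 0 \<subseteq> words L" by (auto simp: normal_words_def words_def)
  with q have "q \<in> carrier (free_algebra L)" by (auto simp: carrier_free_algebra)
  then have "?Q (UEA_class L q)"
    using k diff[of q] by (simp add: qk irr_free_def UEA_class_closed)
  then have "?Q (virt_proj m0 m1 n (UEA_class X (gl_monomial w)))"
    unfolding virt_proj_def by (rule someI)
  then show ?thesis
    using that by (auto simp: carrier_gl_UEA diff)
qed

end

section \<open>Highest weight vectors\<close>

text \<open>All letters have parity 1, so every sign has exponent 4 and the supercommutator relation
  becomes the ordinary one.\<close>

lemma gl_module_imp_gl_rep:
  assumes "gl_module n scale \<rho>"
  shows "gl_rep scale (proper_symbols n) \<rho>"
proof -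
  let ?L = "proper_symbols n"
  have V: "vector_space scale"
    and lin: "\<And>a b. a \<in> ?L \<Longrightarrow> b \<in> ?L \<Longrightarrow> Vector_Spaces.linear scale scale (\<rho> a b)"
    and comm: "\<And>a b c d x. a \<in> ?L \<Longrightarrow> b \<in> ?L \<Longrightarrow> c \<in> ?L \<Longrightarrow> d \<in> ?L \<Longrightarrow>
      \<rho> a b (\<rho> c d x) - \<rho> c d (\<rho> a b x) =
          (if b = c then \<rho> a d x else 0) - (if a = d then \<rho> c b x else 0)"
    using assms unfolding gl_module_def by blast+
  have parity: "parity a = 1" if "a \<in> ?L" for a using that by (auto simp: proper_symbols_def)
  interpret vector_space scale by (rule V)
  show ?thesis
  proof
    fix a b c d x assume "a \<in> ?L" "b \<in> ?L" "c \<in> ?L" "d \<in> ?L"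
    then show "\<rho> a b (\<rho> c d x) =
        scale ((- 1) ^ ((parity a + parity b) * (parity c + parity d)))
          (\<rho> c d (\<rho> a b x) - (if a = d then \<rho> c b x else 0)) + (if b = c then \<rho> a d x else 0)"
      using comm[of a b c d x] by (simp add: parity algebra_simps)
  next
    fix a b r x y assume "a \<in> ?L" "b \<in> ?L"
    then interpret Vector_Spaces.linear scale scale "\<rho> a b" by (rule lin)
    show "\<rho> a b (x + y) = \<rho> a b x + \<rho> a b y" by (rule add)
    show "\<rho> a b (scale r x) = scale r (\<rho> a b x)" by (rule scale)
  qed
qed

text \<open>Serves to compare two highest weight vectors of equal weight: their pair is a highest
  weight vector of the product.\<close>

lemma gl_rep_prod:
  assumes "gl_rep s1 X \<rho>1" "gl_rep s2 X \<rho>2"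
  shows "gl_rep (\<lambda>r (x, y). (s1 r x, s2 r y)) X (\<lambda>a b (x, y). (\<rho>1 a b x, \<rho>2 a b y))"
proof -
  interpret A: gl_rep s1 X \<rho>1 by fact
  interpret B: gl_rep s2 X \<rho>2 by fact
  show ?thesis
  proof
    fix a b c d x assume "a \<in> X" "b \<in> X" "c \<in> X" "d \<in> X"
    then show "(case case x of (x, y) \<Rightarrow> (\<rho>1 c d x, \<rho>2 c d y) of (x, y) \<Rightarrow> (\<rho>1 a b x, \<rho>2 a b y)) =
       (case (case case x of (x, y) \<Rightarrow> (\<rho>1 a b x, \<rho>2 a b y) of (x, y) \<Rightarrow> (\<rho>1 c d x, \<rho>2 c d y)) -
              (if a = d then case x of (x, y) \<Rightarrow> (\<rho>1 c b x, \<rho>2 c b y) else 0) of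
        (x, y) \<Rightarrow>
          (s1 ((- 1) ^ ((parity a + parity b) * (parity c + parity d))) x,
           s2 ((- 1) ^ ((parity a + parity b) * (parity c + parity d))) y)) +
       (if b = c then case x of (x, y) \<Rightarrow> (\<rho>1 a d x, \<rho>2 a d y) else 0)"
      using A.rho_comm[of a b c d "fst x"] B.rho_comm[of a b c d "snd x"]
      by (cases x) (auto simp: zero_prod_def)
  qed (auto simp: A.rho_add B.rho_add A.rho_scale B.rho_scale algebra_simps
      A.scale_right_distrib A.scale_left_distrib B.scale_right_distrib B.scale_left_distrib)
qed

lemma free_act_prod:
  "free_act (\<lambda>r (x, y). (s1 r x, s2 r y)) (\<lambda>a b (x, y). (\<rho>1 a b x, \<rho>2 a b y)) p (x, y) =
    (free_act s1 \<rho>1 p x, free_act s2 \<rho>2 p y)"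
proof -
  have "foldr (\<lambda>(a, b) (x, y). (\<rho>1 a b x, \<rho>2 a b y)) w (x, y) =
      (foldr (\<lambda>(a, b). \<rho>1 a b) w x, foldr (\<lambda>(a, b). \<rho>2 a b) w y)" for w
    by (induction w) auto
  then show ?thesis
    by (intro prod_eqI) (simp_all add: free_act_def fst_sum snd_sum)
qed

section \<open>Lowering operators and the top weight space\<close>

locale gl_even_rep = gl_rep scale "proper_symbols n" \<rho>
  for n :: nat and scale :: "complex \<Rightarrow> 'v::ab_group_add \<Rightarrow> 'v" and \<rho>
begin

definition E :: "nat \<Rightarrow> nat \<Rightarrow> 'v \<Rightarrow> 'v" where
  "E i j = \<rho> (Letter i) (Letter j)"

lemma E_linear:
  assumes "i < n" "j < n"
  shows "E i j (x + y) = E i j x + E i j y" "E i j (scale r x) = scale r (E i j x)"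
  using assms by (auto simp: E_def rho_add rho_scale proper_symbols_def)

lemma E_comm:
  assumes "i < n" "j < n" "k < n" "l < n"
  shows "E i j (E k l x) = E k l (E i j x) + (if j = k then E i l x else 0) - (if i = l then E k j x else 0)"
  using assms rho_comm[of "Letter i" "Letter j" "Letter k" "Letter l" x]
  by (auto simp: E_def proper_symbols_def)

text \<open>The only role of this Cartan element is that lowering operators strictly raise its eigenvalue.\<close>

definition height :: "'v \<Rightarrow> 'v" where
  "height x = (\<Sum>i<n. scale (of_nat i) (E i i x))"

lemma height_linear:
  "height (x + y) = height x + height y" "height (scale r x) = scale r (height x)"
  by (simp_all add: height_def E_linear scale_right_distrib sum.distrib scale_sum_right mult.commute)

lemma height_diff: "height (x - y) = height x - height y"
  using height_linear(1)[of "x - y" y] by (simp add: algebra_simps)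

text \<open>\<open>E i j\<close> has weight \<open>i - j\<close> under the Cartan element: moving it
  past \<open>E k k\<close> produces extra terms only for \<open>k = i\<close> and
  \<open>k = j\<close>.\<close>

lemma height_E:
  assumes "i < n" "j < n"
  shows "height (E i j x) = E i j (height x) + scale (of_nat i - of_nat j) (E i j x)"
proof -
  have E_sum: "E i j (\<Sum>k\<in>K. f k) = (\<Sum>k\<in>K. E i j (f k))" if "finite K" for K and f :: "nat \<Rightarrow> 'v"
    using that E_linear(2)[OF assms, of 0 0] by induction (simp_all add: E_linear assms)
  have "height (E i j x) = (\<Sum>k<n. scale (of_nat k) (E i j (E k k x)) +
      ((if k = i then scale (of_nat i) (E i j x) else 0) - (if k = j then scale (of_nat j) (E i j x) else 0)))"
    unfolding height_def using assms
    by (intro sum.cong) (auto simp: E_comm[of _ _ i j] scale_right_distrib scale_right_diff_distrib algebra_simps)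
  also have "\<dots> = E i j (height x) + scale (of_nat i - of_nat j) (E i j x)"
    using assms
    by (simp add: sum.distrib sum_subtractf height_def E_sum E_linear scale_left_diff_distrib)
  finally show ?thesis .
qed

definition low :: "(nat \<times> nat) list \<Rightarrow> 'v \<Rightarrow> 'v" where
  "low w = foldr (\<lambda>(i, j). E i j) w"

lemma low_simps [simp]: "low [] x = x" "low ((i, j) # w) x = E i j (low w x)"
  by (simp_all add: low_def)

definition low_words :: "(nat \<times> nat) list set" where
  "low_words = {w. \<forall>(i, j) \<in> set w. j < i \<and> i < n}"

text \<open>For a highest weight vector \<open>u\<close> this turns out to be closed under all
  \<open>E i j\<close>, and so to contain the submodule generated by \<open>u\<close>.\<close>

definition low_span :: "'v \<Rightarrow> 'v set" where
  "low_span u = span ((\<lambda>w. low w u) ` low_words)"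

lemma self_low_span: "u \<in> low_span u"
proof -
  have "low [] u \<in> (\<lambda>w. low w u) ` low_words" by (rule imageI) (simp add: low_words_def)
  then show ?thesis unfolding low_span_def by (simp add: span_base)
qed

lemma E_span:
  assumes "i < n" "j < n" "\<And>x. x \<in> S \<Longrightarrow> E i j x \<in> span T" "x \<in> span S"
  shows "E i j x \<in> span T"
  using assms(4)
proof (induction rule: span_induct_alt)
  case base
  then show ?case using E_linear(2)[OF assms(1,2), of 0 0] span_zero by simp
next
  case (step c x y)
  then show ?case by (simp add: assms E_linear span_add span_scale)
qed

lemma E_low_span:
  assumes "j < i" "i < n" "x \<in> low_span u"
  shows "E i j x \<in> low_span u"
  unfolding low_span_def
proof (rule E_span)
  fix y assume "y \<in> (\<lambda>w. low w u) ` low_words"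
  then obtain w where "y = low w u" "w \<in> low_words" by blast
  then have "E i j y = low ((i, j) # w) u" "(i, j) # w \<in> low_words"
    using assms by (auto simp: low_words_def)
  then show "E i j y \<in> span ((\<lambda>w. low w u) ` low_words)" by (metis imageI span_base)
qed (use assms in \<open>auto simp: low_span_def\<close>)

context
  fixes u :: 'v and wt :: "nat \<Rightarrow> complex"
  assumes u: "highest_weight_vector n scale \<rho> wt u"
begin

text \<open>Moving \<open>E i j\<close> past the first lowering operator leaves commutators that act
  on the shorter word, and the induction hypothesis covers all index pairs. On \<open>u\<close>
  itself the operator vanishes, scales or lowers.\<close>

lemma E_low:
  assumes "i < n" "j < n" "w \<in> low_words"
  shows "E i j (low w u) \<in> low_span u"
  using assms
proof (induction w arbitrary: i j)
  case Nil
  have "u \<in> low_span u"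
    by (rule self_low_span)
  moreover have "i < j \<Longrightarrow> E i j u = 0" "i = j \<Longrightarrow> E i j u = scale (wt i) u"
    using u Nil by (auto simp: highest_weight_vector_def E_def)
  ultimately show ?case
    using E_low_span[of j i u u] Nil span_zero span_scale
    by (cases i j rule: linorder_cases) (auto simp: low_span_def)
next
  case (Cons x w)
  obtain k l where x: "x = (k, l)" by force
  have kl: "l < k" "k < n" and w: "w \<in> low_words" using Cons.prems x by (auto simp: low_words_def)
  have "E i j (low w u) \<in> low_span u" "E i l (low w u) \<in> low_span u" "E k j (low w u) \<in> low_span u"
    using Cons kl w by auto
  moreover from this(1) have "E k l (E i j (low w u)) \<in> low_span u"
    by (rule E_low_span[OF kl])
  ultimately have "E k l (E i j (low w u)) + (if j = k then E i l (low w u) else 0)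
      - (if i = l then E k j (low w u) else 0) \<in> low_span u"
    using span_zero unfolding low_span_def by (auto intro!: span_add span_diff)
  then show ?case
    using Cons.prems kl by (simp add: x E_comm[of i j k l])
qed

lemma act_low_span:
  assumes "p \<in> carrier (free_algebra (proper_symbols n))"
  shows "act p u \<in> low_span u"
  using assms unfolding carrier_free_algebra mem_Collect_eq
proof (induction p rule: keys_induct)
  case zero
  then show ?case by (simp add: low_span_def span_zero)
next
  case (single w c)
  have "word_act w u \<in> low_span u" if "set w \<subseteq> proper_symbols n \<times> proper_symbols n" for w
    using that
  proof (induction w)
    case Nil
    then show ?case
      by (simp add: self_low_span)
  next
    case (Cons x w)
    then obtain i j where x: "x = (Letter i, Letter j)" "i < n" "j < n"
      by (auto simp: proper_symbols_def)
    then have "E i j (word_act w u) \<in> low_span u"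
      using E_span[of i j "(\<lambda>w. low w u) ` low_words"] E_low Cons.IH Cons.prems
      unfolding low_span_def by (metis (no_types, lifting) imageE insert_subset list.simps(15))
    then show ?case by (simp add: x E_def)
  qed
  with single show ?case by (auto simp: act_single words_def low_span_def intro!: span_scale)
next
  case (add p q)
  then show ?case by (simp add: act_add low_span_def span_add)
qed

definition h0 :: complex where
  "h0 = (\<Sum>i<n. of_nat i * wt i)"

lemma height_u: "height u = scale h0 u"
  using u by (simp add: height_def h0_def highest_weight_vector_def E_def scale_sum_left)

text \<open>The product of the operators \<open>height - (h0 + k)\<close> over
  \<open>k = 1, ..., m\<close>. It annihilates eigenvectors with eigenvalues
  \<open>h0 + 1, ..., h0 + m\<close> and is injective on the eigenspace of \<open>h0\<close>, which
  separates \<open>u\<close> from the nonempty lowering words.\<close>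

fun kill :: "nat \<Rightarrow> 'v \<Rightarrow> 'v" where
  "kill 0 x = x"
| "kill (Suc m) x = height (kill m x) - scale (h0 + of_nat (Suc m)) (kill m x)"

lemma kill_linear: "kill m (x + y) = kill m x + kill m y \<and> kill m (scale r x) = scale r (kill m x)"
  by (induction m)
    (simp_all add: height_linear scale_right_distrib scale_right_diff_distrib mult.commute)

lemma kill_mono:
  assumes "kill m x = 0" "m \<le> m'"
  shows "kill m' x = 0"
  using assms(2,1)
proof (induction rule: dec_induct)
  case (step k)
  then show ?case using height_linear(2)[of 0 0] by simp
qed

lemma kill_eigen:
  assumes "height x = scale c x"
  shows "kill m x = scale (\<Prod>j<m. c - h0 - of_nat (Suc j)) x"
proof (induction m)
  case (Suc m)
  then show ?case
    by (simp add: height_linear assms algebra_simps flip: scale_left_diff_distrib scale_left_distrib)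
qed simp

definition killed :: "'v set" where
  "killed = {x. \<exists>m. kill m x = 0}"

lemma killed_add: "x \<in> killed \<Longrightarrow> y \<in> killed \<Longrightarrow> x + y \<in> killed"
  unfolding killed_def mem_Collect_eq
  using kill_mono kill_linear by (metis add_0 max.cobounded1 max.cobounded2)

lemma killed_scale: "x \<in> killed \<Longrightarrow> scale r x \<in> killed"
  unfolding killed_def mem_Collect_eq using kill_linear by (metis scale_zero_right)

text \<open>The empty word gives \<open>u\<close>. Each letter \<open>(i, j)\<close> of a lowering
  word raises the eigenvalue of \<open>height\<close> by \<open>i - j > 0\<close>, so all other
  words give vectors in \<open>killed\<close>.\<close>

lemma low_span_decomp:
  assumes "x \<in> low_span u"
  shows "\<exists>r. \<exists>b \<in> killed. x = scale r u + b"
  using assms unfolding low_span_def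
proof (induction rule: span_induct_alt)
  case base
  have "0 \<in> killed" unfolding killed_def by (auto intro!: exI[of _ 0])
  then show ?case by (intro exI[of _ 0] bexI[of _ 0]) auto
next
  case (step c y x)
  have "\<exists>k. height (low w u) = scale (h0 + of_nat k) (low w u) \<and> (w = [] \<or> k > 0)" if "w \<in> low_words" for w
    using that
  proof (induction w)
    case Nil
    then show ?case by (auto simp: height_u intro!: exI[of _ 0])
  next
    case (Cons x w)
    obtain i j where x: "x = (i, j)" by force
    with Cons.prems have ij: "j < i" "i < n" and "w \<in> low_words" by (auto simp: low_words_def)
    with Cons.IH obtain k where k: "height (low w u) = scale (h0 + of_nat k) (low w u)" by blast
    have "h0 + of_nat k + (of_nat i - of_nat j) = h0 + of_nat (k + (i - j))" using ij by (simp add: of_nat_diff)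
    moreover have "height (low (x # w) u) = scale (h0 + of_nat k + (of_nat i - of_nat j)) (low (x # w) u)"
      using ij by (simp add: x height_E k E_linear flip: scale_left_distrib)
    ultimately have "height (low (x # w) u) = scale (h0 + of_nat (k + (i - j))) (low (x # w) u)" by simp
    then show ?case using ij by (intro exI[of _ "k + (i - j)"]) auto
  qed
  with step(1) obtain w k where y: "y = low w u" and k: "height y = scale (h0 + of_nat k) y" "w = [] \<or> k > 0"
    by blast
  obtain r b where x: "b \<in> killed" "x = scale r u + b" using step by blast
  show ?case
  proof (cases "w = []")
    case True
    then have "scale c y + x = scale (c + r) u + b" by (simp add: x y scale_left_distrib algebra_simps)
    then show ?thesis using x by blast
  next
    case False
    with k obtain k' where "k = Suc k'" by (cases k) auto
    \<comment> \<open>The product in \<open>kill_eigen\<close> has a vanishing factor at index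
      \<open>k'\<close>, as \<open>Suc k' = k\<close>.\<close>
    then have "kill k y = 0" using k by (subst kill_eigen) auto
    then have "y \<in> killed" unfolding killed_def by blast
    then have "scale c y + b \<in> killed" using x killed_add killed_scale by blast
    moreover have "scale c y + x = scale r u + (scale c y + b)" by (simp add: x algebra_simps)
    ultimately show ?thesis by blast
  qed
qed

text \<open>The top weight space of the cyclic module is a line: the remainder \<open>b\<close> of
  \<open>act p u\<close> modulo multiples of \<open>u\<close> has eigenvalue \<open>h0\<close> as
  well. On it \<open>kill m\<close> is multiplication by a nonzero number, so
  \<open>b = 0\<close>.\<close>

lemma act_eigen:
  assumes "p \<in> carrier (free_algebra (proper_symbols n))"
    and "height (act p u) = scale h0 (act p u)"
  shows "\<exists>r. act p u = scale r u"
proof -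
  obtain r b where b: "b \<in> killed" and eq: "act p u = scale r u + b"
    using low_span_decomp act_low_span assms(1) by blast
  have bx: "b = act p u - scale r u" by (simp add: eq)
  have "height b = scale h0 b"
    unfolding bx using assms(2)
    by (simp add: height_diff height_linear height_u scale_right_diff_distrib mult.commute)
  moreover obtain m where "kill m b = 0" using b by (auto simp: killed_def)
  ultimately have "(\<Prod>j<m. - (of_nat (Suc j)) :: complex) = 0 \<or> b = 0"
    using kill_eigen[of b h0 m] by simp
  moreover have "- (of_nat (Suc j)) \<noteq> (0::complex)" for j unfolding neg_equal_0_iff_equal of_nat_eq_0_iff by simp
  ultimately have "b = 0" using prod_zero_iff by (metis finite_lessThan)
  then show ?thesis using eq by auto
qed

end

end

text \<open>If \<open>p\<close> killed \<open>u\<close> but not \<open>v\<close>, irreducibility would put \<open>(0, v)\<close> into the submodule of the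
  product generated by the highest weight vector \<open>(u, v)\<close>, whose top weight space is a line.\<close>

lemma highest_weight_annihilator:
  fixes s1 :: "complex \<Rightarrow> 'm::ab_group_add \<Rightarrow> 'm" and scale :: "complex \<Rightarrow> 'v::ab_group_add \<Rightarrow> 'v"
  assumes rep: "gl_rep s1 (proper_symbols n) \<rho>1"
    and irr: "irreducible_gl_module n scale \<rho>"
    and u: "highest_weight_vector n s1 \<rho>1 wt u"
    and v: "highest_weight_vector n scale \<rho> wt v"
    and p: "p \<in> carrier (free_algebra (proper_symbols n))"
    and pu: "free_act s1 \<rho>1 p u = 0"
  shows "free_act scale \<rho> p v = 0"
proof (rule ccontr)
  assume pv: "free_act scale \<rho> p v \<noteq> 0"
  let ?L = "proper_symbols n"
  let ?s = "\<lambda>r (x, y). (s1 r x, scale r y)" and ?\<rho> = "\<lambda>a b (x, y). (\<rho>1 a b x, \<rho> a b y)"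
  interpret A: gl_rep s1 ?L \<rho>1 by (rule rep)
  have mod: "gl_module n scale \<rho>"
    and min: "\<And>W. module.subspace scale W \<Longrightarrow>
      (\<And>a b. a \<in> ?L \<Longrightarrow> b \<in> ?L \<Longrightarrow> \<rho> a b ` W \<subseteq> W) \<Longrightarrow> W = {0} \<or> W = UNIV"
    using irr unfolding irreducible_gl_module_def by blast+
  interpret B: gl_rep scale ?L \<rho> by (rule gl_module_imp_gl_rep[OF mod])
  interpret P: gl_even_rep n ?s ?\<rho>
    unfolding gl_even_rep_def by (rule gl_rep_prod[OF rep B.gl_rep_axioms])
  \<comment> \<open>The images of \<open>v\<close> under the annihilator of \<open>u\<close> form a
    submodule of the irreducible module. It contains the nonzero vector \<open>B.act p v\<close>,
    hence everything, in particular \<open>v\<close>.\<close>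
  let ?W = "{B.act q v | q. q \<in> carrier (free_algebra ?L) \<and> A.act q u = 0}"
  have "?W = {0} \<or> ?W = UNIV"
  proof (rule min)
    show "B.subspace ?W"
    proof (rule B.subspaceI)
      show "0 \<in> ?W" by (auto intro!: exI[of _ 0] simp: free_algebra_closed)
    next
      fix x y assume "x \<in> ?W" "y \<in> ?W"
      then obtain q q' where "x = B.act q v" "q \<in> carrier (free_algebra ?L)" "A.act q u = 0"
        "y = B.act q' v" "q' \<in> carrier (free_algebra ?L)" "A.act q' u = 0" by blast
      then have "x + y = B.act (q + q') v \<and> q + q' \<in> carrier (free_algebra ?L) \<and> A.act (q + q') u = 0"
        by (simp add: free_algebra_closed A.act_add B.act_add)
      then show "x + y \<in> ?W" by blast
    next
      fix r x assume "x \<in> ?W"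
      then obtain q where "x = B.act q v" "q \<in> carrier (free_algebra ?L)" "A.act q u = 0" by blast
      then have "scale r x = B.act (gl_scalar r * q) v \<and> gl_scalar r * q \<in> carrier (free_algebra ?L)
          \<and> A.act (gl_scalar r * q) u = 0"
        by (simp add: free_algebra_closed A.act_mult B.act_mult gl_scalar_closed A.act_scalar B.act_scalar)
      then show "scale r x \<in> ?W" by blast
    qed
  next
    fix a b assume ab: "a \<in> ?L" "b \<in> ?L"
    show "\<rho> a b ` ?W \<subseteq> ?W"
    proof
      fix y assume "y \<in> \<rho> a b ` ?W"
      then obtain q where q: "y = \<rho> a b (B.act q v)" "q \<in> carrier (free_algebra ?L)" "A.act q u = 0" by blast
      moreover have g: "gl_gen a b \<in> carrier (free_algebra ?L)" using ab by (intro gl_monomial_closed) auto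
      moreover have "A.act (gl_gen a b) 0 = 0" by (rule A.act_zero_right[OF g])
      ultimately have "y = B.act (gl_gen a b * q) v \<and> gl_gen a b * q \<in> carrier (free_algebra ?L)
          \<and> A.act (gl_gen a b * q) u = 0"
        by (simp add: free_algebra_closed A.act_mult B.act_mult B.act_monomial)
      then show "y \<in> ?W" by blast
    qed
  qed
  moreover have "B.act p v \<in> ?W" using p pu by blast
  ultimately have "v \<in> ?W" using pv by auto
  then obtain q where q: "q \<in> carrier (free_algebra ?L)" "A.act q u = 0" "B.act q v = v" by auto
  have hw: "highest_weight_vector n ?s ?\<rho> wt (u, v)"
    using u v by (auto simp: highest_weight_vector_def zero_prod_def)
  have quv: "P.act q (u, v) = (0, v)" using q by (simp add: free_act_prod)
  have "P.E i i (0, v) = ?s (wt i) (0, v)" if "i < n" for i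
  proof -
    have "\<rho>1 (Letter i) (Letter i) (s1 0 0) = s1 0 (\<rho>1 (Letter i) (Letter i) 0)"
      using that by (intro A.rho_scale) (auto simp: proper_symbols_def)
    then show ?thesis using v that by (simp add: P.E_def highest_weight_vector_def)
  qed
  then have "P.height (0, v) = ?s (P.h0 wt) (0, v)"
    by (simp add: P.height_def P.scale_sum_left[symmetric] del: case_prod_conv)
      (simp add: prod_eq_iff fst_sum snd_sum P.h0_def[OF hw] B.scale_sum_left)
  \<comment> \<open>By \<open>act_eigen\<close> the vector \<open>(0, v)\<close> is a multiple of
    \<open>(u, v)\<close>. As \<open>u\<close> is nonzero the factor is 0, which contradicts
    \<open>v \<noteq> 0\<close>.\<close>
  then obtain r where "(0, v) = ?s r (u, v)"
    using P.act_eigen[OF hw q(1)] quv by metis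
  then have "s1 r u = 0" "v = scale r v" by simp_all
  then show False using u v by (auto simp: highest_weight_vector_def)
qed

section \<open>Tensor representation\<close>

type_synonym tensor = "(nat \<Rightarrow> symbol) \<Rightarrow> complex"

definition tensor_scale :: "complex \<Rightarrow> tensor \<Rightarrow> tensor" where
  "tensor_scale r F = (\<lambda>l. r * F l)"

definition parity_below :: "(nat \<Rightarrow> symbol) \<Rightarrow> nat \<Rightarrow> nat" where
  "parity_below l p = (\<Sum>q<p. parity (l q))"

text \<open>Tensors of degree \<open>N\<close> are given by their coordinates: \<open>l p\<close> is the symbol in position \<open>p < N\<close>, and
  the values of \<open>l\<close> beyond \<open>N\<close> are irrelevant parameters.\<close>

definition koszul :: "symbol \<Rightarrow> symbol \<Rightarrow> (nat \<Rightarrow> symbol) \<Rightarrow> nat \<Rightarrow> complex" where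
  "koszul a b l p = (- 1) ^ ((parity a + parity b) * parity_below l p)"

text \<open>Coordinate form of the operator that replaces one \<open>b\<close> by \<open>a\<close>,
  summed over positions: the coordinate at \<open>l\<close> collects those of \<open>F\<close> at
  the words with \<open>b\<close> in place of one \<open>a\<close>. The sign comes from passing the
  preceding symbols.\<close>

definition tensor_act :: "nat \<Rightarrow> symbol \<Rightarrow> symbol \<Rightarrow> tensor \<Rightarrow> tensor" where
  "tensor_act N a b F = (\<lambda>l. \<Sum>p<N. if l p = a then koszul a b l p * F (l(p := b)) else 0)"

lemma koszul_update_le: "q \<le> p \<Longrightarrow> koszul a b (l(p := c)) q = koszul a b l q"
  by (simp add: koszul_def parity_below_def)

text \<open>A replacement at an earlier position changes the parity sum by the parity of the
  replacing operator; this is the source of the super sign.\<close>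

lemma koszul_update_gt:
  assumes "p < q" "l p = a"
  shows "koszul c d (l(p := b)) q =
    (- 1) ^ ((parity a + parity b) * (parity c + parity d)) * koszul c d l q"
proof -
  have "parity_below f q = parity (f p) + (\<Sum>i\<in>{..<q} - {p}. parity (f i))" for f
    unfolding parity_below_def using assms by (intro sum.remove) auto
  from this[of l] this[of "l(p := b)"]
  have "parity_below (l(p := b)) q + parity a = parity_below l q + parity b"
    using assms by simp
  then have "even (parity_below (l(p := b)) q) \<longleftrightarrow> (even (parity_below l q) \<longleftrightarrow> even (parity a + parity b))"
    by (metis even_add)
  then show ?thesis
    by (auto simp: koszul_def minus_one_power_iff)
qed

lemma koszul_mult: "koszul a b l p * koszul b d l p = koszul a d l p"
  by (auto simp: koszul_def minus_one_power_iff)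

lemma vector_space_tensor: "vector_space tensor_scale"
  by standard (auto simp: tensor_scale_def algebra_simps fun_eq_iff)

text \<open>Both products are double sums over pairs of positions. At distinct positions the
  operators commute up to the super sign; equal positions yield exactly the two
  contractions.\<close>

lemma tensor_act_comm:
  "tensor_act N a b (tensor_act N c d F) =
    tensor_scale ((- 1) ^ ((parity a + parity b) * (parity c + parity d)))
      (tensor_act N c d (tensor_act N a b F) - (if a = d then tensor_act N c b F else 0))
    + (if b = c then tensor_act N a d F else 0)"
proof
  fix l
  let ?e = "(- 1) ^ ((parity a + parity b) * (parity c + parity d)) :: complex"
  define t where "t a b c d p q =
    (if l p = a then koszul a b l p *
      (if (l(p := b)) q = c then koszul c d (l(p := b)) q * F (l(p := b, q := d)) else 0) else 0)"
    for a b c d p q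
  have ee: "?e * ?e = 1" by (simp add: minus_one_power_iff)
  have twice: "tensor_act N a b (tensor_act N c d F) l = (\<Sum>p<N. \<Sum>q<N. t a b c d p q)" for a b c d
    unfolding tensor_act_def t_def by (intro sum.cong) (simp_all add: sum_distrib_left)
  have off_diagonal: "t a b c d p q = ?e * t c d a b q p" if pq: "p \<noteq> q" for p q
  proof (cases "l p = a \<and> l q = c")
    case True
    have t: "t a b c d p q = koszul a b l p * koszul c d (l(p := b)) q * F (l(p := b, q := d))"
      "t c d a b q p = koszul c d l q * koszul a b (l(q := d)) p * F (l(p := b, q := d))"
      using pq True by (simp_all add: t_def fun_upd_twist)
    consider "p < q" | "q < p" using pq nat_neq_iff by blast
    then show ?thesis
    proof cases
      case 1
      then show ?thesis
        using True unfolding t by (subst koszul_update_gt[of p q l a]) (simp_all add: koszul_update_le)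
    next
      case 2
      then have "koszul a b (l(q := d)) p = ?e * koszul a b l p"
        using True by (subst koszul_update_gt[of q p l c]) (simp_all add: mult.commute)
      moreover have "koszul c d (l(p := b)) q = koszul c d l q" using 2 by (simp add: koszul_update_le)
      ultimately have "?e * t c d a b q p = (?e * ?e) * t a b c d p q" unfolding t by (simp only: ac_simps)
      then show ?thesis by (simp only: ee mult_1)
    qed
  qed (use pq in \<open>auto simp: t_def\<close>)
  have diagonal: "t a b c d p p = (if b = c then if l p = a then koszul a d l p * F (l(p := d)) else 0 else 0)"
    for a b c d p
    by (auto simp: t_def koszul_update_le simp flip: koszul_mult[of a c l p d])
  \<comment> \<open>The exchange rule is extended to equal positions by a correction term, so that
    the full double sum for the opposite order can be split off.\<close>
  have "t a b c d p q = ?e * t c d a b q p + (if q = p then t a b c d p p - ?e * t c d a b p p else 0)" for p q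
    using off_diagonal[of p q] by simp
  then have "tensor_act N a b (tensor_act N c d F) l = (\<Sum>p<N. \<Sum>q<N. ?e * t c d a b q p
        + (if q = p then t a b c d p p - ?e * t c d a b p p else 0))"
    unfolding twice by (intro sum.cong refl)
  also have "\<dots> = (\<Sum>p<N. \<Sum>q<N. ?e * t c d a b q p) + (\<Sum>p<N. t a b c d p p - ?e * t c d a b p p)"
    by (simp add: sum.distrib)
  also have "(\<Sum>p<N. \<Sum>q<N. ?e * t c d a b q p) = ?e * tensor_act N c d (tensor_act N a b F) l"
    unfolding twice by (subst sum.swap) (simp add: sum_distrib_left)
  also have "(\<Sum>p<N. t a b c d p p - ?e * t c d a b p p) =
      (if b = c then tensor_act N a d F l else 0) - ?e * (if a = d then tensor_act N c b F l else 0)"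
    unfolding diagonal by (auto simp: sum_subtractf tensor_act_def sum_distrib_left)
  finally show "tensor_act N a b (tensor_act N c d F) l =
    (tensor_scale ?e
      (tensor_act N c d (tensor_act N a b F) - (if a = d then tensor_act N c b F else 0))
    + (if b = c then tensor_act N a d F else 0)) l"
    by (simp add: tensor_scale_def right_diff_distrib)
qed

lemma gl_rep_tensor: "gl_rep tensor_scale X (tensor_act N)"
proof -
  interpret vector_space tensor_scale by (rule vector_space_tensor)
  show ?thesis
  proof
    fix a b and F G :: tensor
    show "tensor_act N a b (F + G) = tensor_act N a b F + tensor_act N a b G"
      unfolding tensor_act_def plus_fun_def sum.distrib[symmetric]
      by (intro ext sum.cong) (simp_all add: algebra_simps)
  next
    fix a b r and F :: tensor
    show "tensor_act N a b (tensor_scale r F) = tensor_scale r (tensor_act N a b F)"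
      unfolding tensor_act_def tensor_scale_def sum_distrib_left
      by (intro ext sum.cong) simp_all
  qed (rule tensor_act_comm)
qed

section \<open>Weights of tensors and irregular products\<close>

definition occurrences :: "nat \<Rightarrow> symbol \<Rightarrow> (nat \<Rightarrow> symbol) \<Rightarrow> nat" where
  "occurrences N \<gamma> l = card {p. p < N \<and> l p = \<gamma>}"

text \<open>Weight tensors. The multiplicities \<open>g\<close> are integers because creations and
  annihilations are counted formally; a negative multiplicity forces the tensor to vanish.\<close>

definition homogeneous :: "nat \<Rightarrow> (symbol \<Rightarrow> int) \<Rightarrow> tensor \<Rightarrow> bool" where
  "homogeneous N g F \<longleftrightarrow> (\<forall>l. F l \<noteq> 0 \<longrightarrow> (\<forall>\<gamma>. int (occurrences N \<gamma> l) = g \<gamma>))"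

lemma occurrences_update:
  assumes "p < N"
  shows "int (occurrences N \<gamma> (l(p := b))) =
    int (occurrences N \<gamma> l) - of_bool (l p = \<gamma>) + of_bool (b = \<gamma>)"
proof -
  have "occurrences N \<gamma> f = card {q. q < N \<and> q \<noteq> p \<and> f q = \<gamma>} + of_bool (f p = \<gamma>)" for f
  proof -
    have "{q. q < N \<and> f q = \<gamma>} =
        (if f p = \<gamma> then insert p else id) {q. q < N \<and> q \<noteq> p \<and> f q = \<gamma>}"
      using assms by auto
    then show ?thesis by (simp add: occurrences_def)
  qed
  from this[of l] this[of "l(p := b)"] show ?thesis by (auto cong: conj_cong)
qed

lemma tensor_act_nonzero:
  assumes "tensor_act N a b F l \<noteq> 0"
  obtains p where "p < N" "l p = a" "F (l(p := b)) \<noteq> 0"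
proof -
  obtain p where "p < N" "(if l p = a then koszul a b l p * F (l(p := b)) else 0) \<noteq> 0"
    using assms unfolding tensor_act_def by (rule sum.not_neutral_contains_not_neutral) simp
  with that show ?thesis by (auto split: if_splits)
qed

lemma homogeneous_tensor_act:
  assumes "homogeneous N g F"
  shows "homogeneous N (\<lambda>\<gamma>. g \<gamma> + of_bool (a = \<gamma>) - of_bool (b = \<gamma>)) (tensor_act N a b F)"
  unfolding homogeneous_def
proof (intro allI impI)
  fix l \<gamma> assume "tensor_act N a b F l \<noteq> 0"
  then obtain p where p: "p < N" "l p = a" "F (l(p := b)) \<noteq> 0" by (rule tensor_act_nonzero)
  then have "int (occurrences N \<gamma> (l(p := b))) = g \<gamma>" using assms by (simp add: homogeneous_def)
  then show "int (occurrences N \<gamma> l) = g \<gamma> + of_bool (a = \<gamma>) - of_bool (b = \<gamma>)"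
    using occurrences_update[OF p(1), of \<gamma> l b] p(2) by simp
qed

abbreviation tensor_word :: "nat \<Rightarrow> (symbol \<times> symbol) list \<Rightarrow> tensor \<Rightarrow> tensor" where
  "tensor_word N w \<equiv> foldr (\<lambda>(a, b). tensor_act N a b) w"

lemma homogeneous_tensor_word:
  assumes "homogeneous N g F"
  shows "homogeneous N (\<lambda>\<gamma>. g \<gamma> + int (length (filter (\<lambda>x. fst x = \<gamma>) w))
    - int (length (filter (\<lambda>x. snd x = \<gamma>) w))) (tensor_word N w F)"
proof (induction w)
  case (Cons x w)
  obtain a b where x: "x = (a, b)" by force
  have eq: "(\<lambda>\<gamma>. g \<gamma> + int (length (filter (\<lambda>x. fst x = \<gamma>) (x # w)))
      - int (length (filter (\<lambda>x. snd x = \<gamma>) (x # w)))) =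
    (\<lambda>\<gamma>. g \<gamma> + int (length (filter (\<lambda>x. fst x = \<gamma>) w))
      - int (length (filter (\<lambda>x. snd x = \<gamma>) w)) + of_bool (a = \<gamma>) - of_bool (b = \<gamma>))"
    by (auto simp: x fun_eq_iff)
  show ?case
    using homogeneous_tensor_act[OF Cons, of a b] unfolding eq by (simp add: x)
qed (simp add: assms)

lemma tensor_act_zero: "tensor_act N a b 0 = 0"
  by (simp add: tensor_act_def fun_eq_iff cong: if_cong)

lemma tensor_word_zero: "tensor_word N w 0 = 0"
  by (induction w) (auto simp: tensor_act_zero[unfolded zero_fun_def])

text \<open>Before the offending factor acts, the tensor contains \<open>\<gamma>\<close> as often
  as creations exceed annihilations. Irregularity makes this number negative, or at most zero while
  the factor has to remove \<open>\<gamma>\<close>.\<close>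

lemma irregular_kills:
  assumes "homogeneous N g F" "\<And>\<gamma>. \<gamma> \<in> virtual_symbols m0 m1 \<Longrightarrow> g \<gamma> = 0" "irregular m0 m1 w"
  shows "tensor_word N w F = 0"
proof -
  obtain i \<gamma> where i: "i < length w" and \<gamma>: "\<gamma> \<in> virtual_symbols m0 m1"
    and less: "card {j. j < i \<and> fst (rev w ! j) = \<gamma>} < card {j. j \<le> i \<and> snd (rev w ! j) = \<gamma>}"
    using assms(3) by (auto simp: irregular_def)
  obtain a b where ab: "rev w ! i = (a, b)" by force
  \<comment> \<open>The factors to the right of the offending one: irregularity counts from the
    right, so they are the first \<open>i\<close> of the reversed word.\<close>
  define v where "v = rev (take i (rev w))"
  have "rev w = take i (rev w) @ (a, b) # drop (Suc i) (rev w)"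
    using i ab by (metis id_take_nth_drop length_rev)
  then have w: "w = rev (drop (Suc i) (rev w)) @ (a, b) # v"
    unfolding v_def by (metis append_Cons append_Nil append_assoc rev.simps(2) rev_append rev_rev_ident)
  have "tensor_act N a b (tensor_word N v F) l = 0" for l
  proof (rule ccontr)
    assume "tensor_act N a b (tensor_word N v F) l \<noteq> 0"
    then obtain p where p: "p < N" "tensor_word N v F (l(p := b)) \<noteq> 0" by (rule tensor_act_nonzero)
    have count: "card {j. j < k \<and> P (rev w ! j)} = length (filter P (rev (take k (rev w))))"
      if "k \<le> length w" for P k
      unfolding rev_filter[symmetric] length_rev length_filter_conv_card using that
      by (intro arg_cong[of _ _ card]) auto
    have "int (occurrences N \<gamma> (l(p := b)))
        = int (length (filter (\<lambda>x. fst x = \<gamma>) v)) - int (length (filter (\<lambda>x. snd x = \<gamma>) v))"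
      using homogeneous_tensor_word[OF assms(1), of v] p(2) assms(2)[OF \<gamma>] unfolding homogeneous_def by auto
    moreover have "of_bool (b = \<gamma>) \<le> occurrences N \<gamma> (l(p := b))"
    proof (cases "b = \<gamma>")
      case True
      then have "{p} \<subseteq> {q. q < N \<and> (l(p := b)) q = \<gamma>}" using p by auto
      then have "card {p} \<le> occurrences N \<gamma> (l(p := b))"
        unfolding occurrences_def by (rule card_mono[rotated]) auto
      then show ?thesis by (simp add: True)
    qed simp
    moreover have "{j. j \<le> i \<and> snd (rev w ! j) = \<gamma>}
        = {j. j < i \<and> snd (rev w ! j) = \<gamma>} \<union> (if b = \<gamma> then {i} else {})"
      using ab by (auto simp: le_less)
    then have "card {j. j \<le> i \<and> snd (rev w ! j) = \<gamma>}
        = length (filter (\<lambda>x. snd x = \<gamma>) v) + of_bool (b = \<gamma>)"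
      using count[of i "\<lambda>x. snd x = \<gamma>"] i by (simp add: v_def card_insert_if)
    moreover have "card {j. j < i \<and> fst (rev w ! j) = \<gamma>} = length (filter (\<lambda>x. fst x = \<gamma>) v)"
      using count[of i "\<lambda>x. fst x = \<gamma>"] i by (simp add: v_def)
    ultimately show False using less by (auto split: if_splits)
  qed
  then have "tensor_act N a b (tensor_word N v F) = 0" by (simp add: fun_eq_iff)
  then show ?thesis by (subst w) (simp add: tensor_word_zero)
qed

section \<open>Products of row determinants\<close>

locale young_positions =
  fixes N :: nat and row col :: "nat \<Rightarrow> nat"
  assumes inj: "inj_on (\<lambda>p. (row p, col p)) {..<N}"
    and left_closed: "p < N \<Longrightarrow> i < col p \<Longrightarrow> \<exists>q<N. row q = row p \<and> col q = i"
begin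

definition row_alternating :: "tensor \<Rightarrow> bool" where
  "row_alternating F \<longleftrightarrow>
    (\<forall>l p q. p < N \<longrightarrow> q < N \<longrightarrow> p \<noteq> q \<longrightarrow> row p = row q \<longrightarrow> F (l \<circ> transpose p q) = - F l)"

lemma row_alternating_repeated:
  assumes "row_alternating F" "p < N" "q < N" "p \<noteq> q" "row p = row q" "l p = l q"
  shows "F l = 0"
proof -
  have "l \<circ> transpose p q = l" using assms(6) by (auto simp: fun_eq_iff transpose_def)
  then have "F l = - F l" using assms(1-5) by (metis row_alternating_def)
  then show ?thesis by simp
qed

text \<open>For an even operator all Koszul signs are 1, so it commutes with permutations of
  positions. This covers replacements among letters and beta symbols, all of parity 1.\<close>

lemma row_alternating_act:
  assumes "row_alternating F" "even (parity a + parity b)"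
  shows "row_alternating (tensor_act N a b F)"
  unfolding row_alternating_def
proof (intro allI impI)
  fix l p q assume pq: "p < N" "q < N" "p \<noteq> q" "row p = row q"
  let ?t = "transpose p q"
  have even: "koszul a b l r = 1" for l r using assms(2) by (simp add: koszul_def)
  have "?t permutes {..<N}" using pq by (intro permutes_swap_id) auto
  then have "tensor_act N a b F (l \<circ> ?t) =
      (\<Sum>r<N. (\<lambda>r. if (l \<circ> ?t) r = a then F ((l \<circ> ?t)(r := b)) else 0) (?t r))"
    unfolding tensor_act_def even mult_1 by (subst sum.permute) (assumption, simp only: comp_def)
  also have "\<dots> = (\<Sum>r<N. if l r = a then - F (l(r := b)) else 0)"
  proof (intro sum.cong refl)
    fix r
    have "(l \<circ> ?t)(?t r := b) = l(r := b) \<circ> ?t"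
      by (auto simp: fun_eq_iff transpose_def)
    moreover have "F (l(r := b) \<circ> ?t) = - F (l(r := b))"
      using assms(1) pq by (simp add: row_alternating_def)
    ultimately show "(\<lambda>r. if (l \<circ> ?t) r = a then F ((l \<circ> ?t)(r := b)) else 0) (?t r) =
        (if l r = a then - F (l(r := b)) else 0)" by simp
  qed
  also have "\<dots> = - tensor_act N a b F l"
    unfolding tensor_act_def even mult_1 sum_negf[symmetric] by (intro sum.cong) auto
  finally show "tensor_act N a b F (l \<circ> ?t) = - tensor_act N a b F l" .
qed

definition row_group :: "(nat \<Rightarrow> nat) set" where
  "row_group = {\<pi>. \<pi> permutes {..<N} \<and> (\<forall>p. row (\<pi> p) = row p)}"

text \<open>The product of one determinant tensor per row, in the letters given by the columns of
  that row: the signed orbit of the column filling under the row group.\<close>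

definition det_tensor :: tensor where
  "det_tensor l = (\<Sum>\<pi>\<in>row_group.
    if \<forall>p<N. l p = Letter (col (\<pi> p)) then of_int (sign \<pi>) else 0)"

lemma finite_row_group: "finite row_group"
  unfolding row_group_def by (rule finite_subset[OF _ finite_permutations[of "{..<N}"]]) auto

lemma det_tensor_nonzero:
  assumes "det_tensor l \<noteq> 0"
  obtains \<pi> where "\<pi> permutes {..<N}" "\<And>p. row (\<pi> p) = row p" "\<And>p. p < N \<Longrightarrow> l p = Letter (col (\<pi> p))"
proof -
  obtain \<pi> where "\<pi> \<in> row_group" "\<forall>p<N. l p = Letter (col (\<pi> p))"
    using assms unfolding det_tensor_def
    by (rule sum.not_neutral_contains_not_neutral) (simp split: if_splits)
  with that show ?thesis by (auto simp: row_group_def)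
qed

lemma row_alternating_det: "row_alternating det_tensor"
  unfolding row_alternating_def
proof (intro allI impI)
  fix l p q assume pq: "p < N" "q < N" "p \<noteq> q" "row p = row q"
  let ?t = "transpose p q"
  have t: "?t permutes {..<N}" using pq by (intro permutes_swap_id) auto
  have row_t: "row (?t r) = row r" for r using pq(4) by (simp add: transpose_def)
  have tt: "?t (?t r) = r" for r by simp
  have mem: "\<pi> \<circ> ?t \<in> row_group" if "\<pi> \<in> row_group" for \<pi>
    using that permutes_compose[OF t] by (auto simp: row_group_def row_t)
  have bij: "bij_betw (\<lambda>\<pi>. \<pi> \<circ> ?t) row_group row_group"
    by (rule bij_betw_byWitness[of _ "\<lambda>\<pi>. \<pi> \<circ> ?t"]) (auto simp: mem comp_assoc)
  have cond: "(\<forall>r<N. (l \<circ> ?t) r = Letter (col ((\<pi> \<circ> ?t) r))) \<longleftrightarrow> (\<forall>r<N. l r = Letter (col (\<pi> r)))" for \<pi>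
    using permutes_in_image[OF t] tt by (metis comp_apply lessThan_iff)
  have sgn: "sign (\<pi> \<circ> ?t) = - sign \<pi>" if "\<pi> \<in> row_group" for \<pi>
    using that pq(3) by (subst sign_compose)
      (auto simp: row_group_def sign_swap_id permutation_swap_id intro: permutation_permutes[THEN iffD2])
  have "det_tensor (l \<circ> ?t) = (\<Sum>\<pi>\<in>row_group.
      if \<forall>r<N. (l \<circ> ?t) r = Letter (col ((\<pi> \<circ> ?t) r)) then of_int (sign (\<pi> \<circ> ?t)) else 0)"
    unfolding det_tensor_def by (rule sum.reindex_bij_betw[OF bij, symmetric])
  also have "\<dots> = (\<Sum>\<pi>\<in>row_group. - (if \<forall>r<N. l r = Letter (col (\<pi> r)) then of_int (sign \<pi>) else 0))"
    unfolding cond by (intro sum.cong) (auto simp: sgn)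
  finally show "det_tensor (l \<circ> ?t) = - det_tensor l"
    by (simp add: det_tensor_def sum_negf)
qed

text \<open>A row permutation that also preserves columns fixes every cell, so only the identity
  contributes. This shows that \<open>det_tensor\<close> is nonzero.\<close>

lemma det_tensor_diagonal: "det_tensor (\<lambda>p. Letter (col p)) = 1"
proof -
  have "\<pi> = id" if \<pi>: "\<pi> \<in> row_group" "\<forall>p<N. Letter (col p) = Letter (col (\<pi> p))" for \<pi>
  proof
    fix p
    show "\<pi> p = id p"
    proof (cases "p < N")
      case True
      then have "\<pi> p < N" using \<pi> permutes_in_image by (fastforce simp: row_group_def)
      moreover have "row (\<pi> p) = row p" "col (\<pi> p) = col p" using \<pi> True by (auto simp: row_group_def)
      ultimately show ?thesis using inj_onD[OF inj, of "\<pi> p" p] True by simp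
    next
      case False
      then show ?thesis using \<pi> by (auto simp: row_group_def permutes_def)
    qed
  qed
  then have eq: "(if \<forall>p<N. Letter (col p) = Letter (col (\<pi> p)) then of_int (sign \<pi>) else 0 :: complex)
      = (if \<pi> = id then 1 else 0)" if "\<pi> \<in> row_group" for \<pi>
    using that by (auto simp: sign_id)
  have "id \<in> row_group" by (auto simp: row_group_def permutes_id)
  then show ?thesis
    unfolding det_tensor_def by (subst sum.cong[OF refl eq]) (auto simp: finite_row_group)
qed

lemma homogeneous_det:
  "homogeneous N (\<lambda>\<gamma>. int (card {p. p < N \<and> Letter (col p) = \<gamma>})) det_tensor"
  unfolding homogeneous_def
proof (intro allI impI)
  fix l \<gamma> assume "det_tensor l \<noteq> 0"
  then obtain \<pi> where \<pi>: "\<pi> permutes {..<N}" "\<And>p. p < N \<Longrightarrow> l p = Letter (col (\<pi> p))"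
    using det_tensor_nonzero[of l] by metis
  have "bij_betw \<pi> {p. p < N \<and> l p = \<gamma>} {p. p < N \<and> Letter (col p) = \<gamma>}"
    using \<pi> permutes_in_image[OF \<pi>(1)] permutes_in_image[OF permutes_inv[OF \<pi>(1)]]
    by (intro bij_betw_byWitness[of _ "inv_into UNIV \<pi>"]) (auto simp: permutes_inverses)
  then show "int (occurrences N \<gamma> l) = int (card {p. p < N \<and> Letter (col p) = \<gamma>})"
    unfolding occurrences_def by (simp add: bij_betw_same_card)
qed

text \<open>For \<open>i < j\<close> the operator turns a letter \<open>j\<close> into
  \<open>i\<close> in a row that, being left-justified, already has an \<open>i\<close>; an
  alternating tensor has no such coordinate. The diagonal operators count letters.\<close>

lemma highest_weight_det:
  "highest_weight_vector n tensor_scale (tensor_act N)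
    (\<lambda>i. of_nat (card {p. p < N \<and> col p = i})) det_tensor"
  unfolding highest_weight_vector_def
proof (intro conjI allI impI)
  show "det_tensor \<noteq> 0" using det_tensor_diagonal by auto
next
  fix i j :: nat assume ij: "i < j \<and> j < n"
  show "tensor_act N (Letter i) (Letter j) det_tensor = 0"
  proof (rule ext, unfold zero_fun_apply, rule ccontr)
    fix l assume nonzero: "tensor_act N (Letter i) (Letter j) det_tensor l \<noteq> 0"
    then obtain p where p: "p < N" "l p = Letter i" "det_tensor (l(p := Letter j)) \<noteq> 0"
      by (rule tensor_act_nonzero)
    from p(3) obtain \<pi> where \<pi>: "\<pi> permutes {..<N}" "\<And>p. row (\<pi> p) = row p"
      "\<And>q. q < N \<Longrightarrow> (l(p := Letter j)) q = Letter (col (\<pi> q))"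
      by (rule det_tensor_nonzero) blast
    have "\<pi> p < N" using permutes_in_image[OF \<pi>(1)] p(1) by simp
    moreover have "i < col (\<pi> p)" using \<pi>(3)[OF p(1)] ij by simp
    ultimately obtain q' where q': "q' < N" "row q' = row p" "col q' = i"
      using left_closed[of "\<pi> p" i] \<pi>(2) by auto
    \<comment> \<open>\<open>q\<close> is the position that carries the letter \<open>i\<close> in
      the row of \<open>p\<close> before the replacement.\<close>
    define q where "q = inv_into UNIV \<pi> q'"
    have "\<pi> q = q'" unfolding q_def using permutes_inverses(1)[OF \<pi>(1)] by simp
    then have q: "q < N" "row q = row p"
      using permutes_in_image[OF \<pi>(1), of q] q' \<pi>(2)[of q] by auto
    moreover have "p \<noteq> q" using \<pi>(3)[OF p(1)] ij q'(3) \<open>\<pi> q = q'\<close> by auto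
    moreover have "l q = Letter i" using \<pi>(3)[OF q(1)] \<open>p \<noteq> q\<close> \<open>\<pi> q = q'\<close> q'(3) by simp
    moreover have "row_alternating (tensor_act N (Letter i) (Letter j) det_tensor)"
      by (intro row_alternating_act row_alternating_det) simp
    ultimately show False
      using row_alternating_repeated[of _ p q l] p nonzero by simp
  qed
next
  fix i :: nat
  have "tensor_act N (Letter i) (Letter i) det_tensor l =
      (\<Sum>p<N. if l p = Letter i then det_tensor l else 0)" for l
    unfolding tensor_act_def by (intro sum.cong) (auto simp: koszul_def fun_upd_idem minus_one_power_iff)
  also have "\<dots> l = of_nat (occurrences N (Letter i) l) * det_tensor l" for l
    by (simp add: occurrences_def sum.If_cases lessThan_def Collect_conj_eq)
  also have "\<dots> l = of_nat (card {p. p < N \<and> col p = i}) * det_tensor l" for l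
    using homogeneous_det by (cases "det_tensor l = 0") (auto simp: homogeneous_def)
  finally show "tensor_act N (Letter i) (Letter i) det_tensor =
      tensor_scale (of_nat (card {p. p < N \<and> col p = i})) det_tensor"
    by (simp add: fun_eq_iff tensor_scale_def)
qed

text \<open>Row by row: if some column index of the row is at least \<open>t\<close>, then the row meets all of the first
  \<open>t\<close> columns and contains at most \<open>t\<close> of the symbols; otherwise it lies in the first \<open>t\<close> columns.\<close>

lemma gale_ryser:
  assumes "\<And>p q. p < N \<Longrightarrow> q < N \<Longrightarrow> p \<noteq> q \<Longrightarrow> row p = row q \<Longrightarrow> l p \<noteq> l q"
  shows "(\<Sum>j<t. occurrences N (Beta j) l) \<le> (\<Sum>j<t. card {p. p < N \<and> col p = j})"
proof -
  define A where "A k = {p. p < N \<and> row p = k \<and> l p \<in> Beta ` {..<t}}" for k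
  define B where "B k = {p. p < N \<and> row p = k \<and> col p < t}" for k
  have fin: "finite (A k)" "finite (B k)" for k by (simp_all add: A_def B_def)
  have AB: "card (A k) \<le> card (B k)" for k
  proof (cases "\<exists>p<N. row p = k \<and> t \<le> col p")
    case True
    then obtain p where p: "p < N" "row p = k" "t \<le> col p" by blast
    have "inj_on l (A k)"
      by (rule inj_onI, rule ccontr) (use assms in \<open>auto simp: A_def\<close>)
    moreover have "l ` A k \<subseteq> Beta ` {..<t}" by (auto simp: A_def)
    ultimately have "card (A k) \<le> card (Beta ` {..<t})" by (intro card_inj_on_le[of l]) auto
    also have "\<dots> \<le> card {..<t}" by (rule card_image_le) simp
    also have "{..<t} \<subseteq> col ` B k"
    proof
      fix i assume "i \<in> {..<t}"
      then show "i \<in> col ` B k" using left_closed[OF p(1), of i] p by (auto simp: B_def)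
    qed
    then have "card {..<t} \<le> card (col ` B k)" by (intro card_mono) (simp_all add: fin)
    also have "\<dots> \<le> card (B k)" by (rule card_image_le[OF fin(2)])
    finally show ?thesis .
  next
    case False
    then have "A k \<subseteq> B k" by (auto simp: A_def B_def not_le)
    then show ?thesis by (rule card_mono[OF fin(2)])
  qed
  have "(\<Sum>j<t. occurrences N (Beta j) l) = card (\<Union>j<t. {p. p < N \<and> l p = Beta j})"
    unfolding occurrences_def by (subst card_UN_disjoint) auto
  also have "(\<Union>j<t. {p. p < N \<and> l p = Beta j}) = (\<Union>k\<in>row ` {..<N}. A k)"
    by (auto simp: A_def)
  also have "card \<dots> = (\<Sum>k\<in>row ` {..<N}. card (A k))"
    by (rule card_UN_disjoint) (auto simp: A_def)
  also have "\<dots> \<le> (\<Sum>k\<in>row ` {..<N}. card (B k))" by (rule sum_mono) (rule AB)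
  also have "\<dots> = card (\<Union>k\<in>row ` {..<N}. B k)"
    by (rule card_UN_disjoint[symmetric]) (auto simp: B_def)
  also have "(\<Union>k\<in>row ` {..<N}. B k) = (\<Union>j<t. {p. p < N \<and> col p = j})"
    by (auto simp: B_def)
  also have "card \<dots> = (\<Sum>j<t. card {p. p < N \<and> col p = j})"
    by (subst card_UN_disjoint) auto
  finally show ?thesis .
qed

end

section \<open>Partitions, and the vanishing theorem\<close>

lemma set_cells: "set (cells \<nu>) = {(i, j). i < length \<nu> \<and> j < \<nu> ! i}"
  by (auto simp: cells_def)

lemma distinct_cells: "distinct (cells \<nu>)"
proof -
  have "distinct (concat (map (\<lambda>i. map (Pair i) [0..<f i]) [0..<k]))" for f :: "nat \<Rightarrow> nat" and k
    by (induction k) (auto simp: distinct_map inj_on_def)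
  then show ?thesis by (simp add: cells_def)
qed

lemma length_cells: "length (cells \<nu>) = sum_list \<nu>"
proof -
  have "length (cells \<nu>) = (\<Sum>i\<leftarrow>[0..<length \<nu>]. \<nu> ! i)"
    by (simp add: cells_def length_concat o_def)
  then show ?thesis by (metis map_nth)
qed

lemma partition_antimono:
  assumes "is_partition \<nu>" "i \<le> j" "j < length \<nu>"
  shows "\<nu> ! j \<le> \<nu> ! i"
  using assms sorted_wrt_nth_less[of "(\<ge>)" \<nu> i j] by (cases "i = j") (auto simp: is_partition_def)

lemma part_nth: "i < length \<nu> \<Longrightarrow> part \<nu> i = \<nu> ! i"
  by (simp add: Defs.part_def nth_default_nth)

lemma nth_le_part:
  assumes "is_partition \<nu>" "i < length \<nu>"
  shows "\<nu> ! i \<le> part \<nu> 0"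
proof -
  have "0 < length \<nu>" using assms(2) by linarith
  then show ?thesis using partition_antimono[OF assms(1), of 0 i] assms(2) by (simp add: part_nth)
qed

lemma part_conj:
  assumes "is_partition \<nu>"
  shows "part (conj_partition \<nu>) j = card {i. i < length \<nu> \<and> j < \<nu> ! i}"
proof (cases "j < part \<nu> 0")
  case True
  then show ?thesis by (simp add: part_nth conj_partition_def)
next
  \<comment> \<open>Beyond the first part no row is long enough, which agrees with the default value
    0 of \<open>part\<close>.\<close>
  case False
  have "\<nu> ! i \<le> part \<nu> 0" if "i < length \<nu>" for i
    using nth_le_part[OF assms that] .
  then have "{i. i < length \<nu> \<and> j < \<nu> ! i} = {}" using False by fastforce
  then show ?thesis using False by (simp add: Defs.part_def conj_partition_def nth_default_def)
qed

lemma card_column: "card {c \<in> set (cells \<nu>). snd c = j} = card {i. i < length \<nu> \<and> j < \<nu> ! i}"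
  by (rule bij_betw_same_card[of fst], rule bij_betw_byWitness[of _ "\<lambda>i. (i, j)"])
    (auto simp: set_cells)

lemma card_index_column:
  "card {p. p < length (cells \<nu>) \<and> snd (cells \<nu> ! p) = j} = card {c \<in> set (cells \<nu>). snd c = j}"
proof (rule bij_betw_same_card[of "(!) (cells \<nu>)"], rule bij_betw_imageI)
  show "inj_on ((!) (cells \<nu>)) {p. p < length (cells \<nu>) \<and> snd (cells \<nu> ! p) = j}"
    using distinct_cells[of \<nu>] by (auto simp: inj_on_def nth_eq_iff_index_eq)
qed (force simp: in_set_conv_nth)

text \<open>Parts decrease, so the rows longer than \<open>i\<close> form an initial segment, and
  comparing \<open>j\<close> with their number tests whether row \<open>j\<close> is one of them.
  This is the symmetry of a diagram under transposition.\<close>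

lemma conj_partition_less_iff:
  assumes "is_partition \<nu>" "i < length (conj_partition \<nu>)"
  shows "j < conj_partition \<nu> ! i \<longleftrightarrow> j < length \<nu> \<and> i < \<nu> ! j"
proof -
  let ?A = "{k. k < length \<nu> \<and> i < \<nu> ! k}"
  have eq: "conj_partition \<nu> ! i = card ?A"
    using assms(2) by (simp add: conj_partition_def)
  have down: "k' \<in> ?A" if "k \<in> ?A" "k' \<le> k" for k k'
    using that partition_antimono[OF assms(1), of k' k] by auto
  have "?A = {..<card ?A}"
  proof (rule ccontr)
    assume neq: "?A \<noteq> {..<card ?A}"
    have fin: "finite ?A" by simp
    have "\<not> ?A \<subseteq> {..<card ?A}" using neq card_subset_eq[of "{..<card ?A}" ?A] by auto
    then obtain k where "k \<in> ?A" "card ?A \<le> k" by (meson lessThan_iff not_le subsetI)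
    then have "{..k} \<subseteq> ?A" using down by blast
    then have "card {..k} \<le> card ?A" by (rule card_mono[OF fin])
    then show False using \<open>card ?A \<le> k\<close> by simp
  qed
  then show ?thesis unfolding eq by blast
qed

text \<open>Transposition turns column \<open>j\<close> of the conjugate shape into row
  \<open>j\<close> of \<open>\<nu>\<close>. Hence \<open>dstar\<close> on that shape contains
  \<open>Beta j\<close> exactly \<open>part \<nu> j\<close> times.\<close>

lemma card_column_conj:
  assumes "is_partition \<nu>"
  shows "card {c \<in> set (cells (conj_partition \<nu>)). snd c = j} = part \<nu> j"
proof -
  have "\<nu> ! j \<le> part \<nu> 0" if "j < length \<nu>"
    using nth_le_part[OF assms that] .
  moreover have "length (conj_partition \<nu>) = part \<nu> 0" by (simp add: conj_partition_def)
  ultimately have "{i. i < length (conj_partition \<nu>) \<and> j < conj_partition \<nu> ! i} =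
      (if j < length \<nu> then {..<\<nu> ! j} else {})"
    using conj_partition_less_iff[OF assms] by auto
  then show ?thesis by (simp add: card_column Defs.part_def nth_default_def)
qed

lemma conj_partition_nth_le: "i < length (conj_partition \<nu>) \<Longrightarrow> conj_partition \<nu> ! i \<le> part (conj_partition \<nu>) 0"
proof -
  assume i: "i < length (conj_partition \<nu>)"
  then have "0 < length (conj_partition \<nu>)" by linarith
  then show ?thesis using i by (auto simp: part_nth conj_partition_def intro!: card_mono)
qed

lemma sum_part: "(\<Sum>j<length \<nu>. part \<nu> j) = sum_list \<nu>"
  by (simp add: part_nth sum_list_sum_nth atLeast0LessThan)

lemma sum_conj_partition:
  assumes "is_partition \<nu>"
  shows "sum_list (conj_partition \<nu>) = sum_list \<nu>"
proof -
  let ?\<nu>' = "conj_partition \<nu>"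
  have "{c \<in> set (cells ?\<nu>'). snd c = j} \<noteq> {} \<Longrightarrow> j < length \<nu>" for j
    using conj_partition_less_iff[OF assms] by (auto simp: set_cells)
  then have "set (cells ?\<nu>') = (\<Union>j<length \<nu>. {c \<in> set (cells ?\<nu>'). snd c = j})"
    by blast
  then have "card (set (cells ?\<nu>')) = (\<Sum>j<length \<nu>. card {c \<in> set (cells ?\<nu>'). snd c = j})"
    using card_UN_disjoint[of "{..<length \<nu>}" "\<lambda>j. {c \<in> set (cells ?\<nu>'). snd c = j}"] by auto
  then show ?thesis
    by (simp add: card_column_conj[OF assms] sum_part distinct_card[OF distinct_cells] length_cells)
qed

lemma young_positions_cells:
  "young_positions (length (cells \<nu>)) (\<lambda>p. fst (cells \<nu> ! p)) (\<lambda>p. snd (cells \<nu> ! p))"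
proof
  show "inj_on (\<lambda>p. (fst (cells \<nu> ! p), snd (cells \<nu> ! p))) {..<length (cells \<nu>)}"
    using distinct_cells[of \<nu>] by (auto simp: inj_on_def nth_eq_iff_index_eq)
next
  fix p i assume "p < length (cells \<nu>)" "i < snd (cells \<nu> ! p)"
  then have "(fst (cells \<nu> ! p), i) \<in> set (cells \<nu>)"
    using nth_mem[of p "cells \<nu>"] by (auto simp: set_cells)
  then show "\<exists>q<length (cells \<nu>). fst (cells \<nu> ! q) = fst (cells \<nu> ! p) \<and> snd (cells \<nu> ! q) = i"
    by (force simp: in_set_conv_nth)
qed

lemma filter_cells_count:
  assumes "inj f"
  shows "length (filter (\<lambda>x. f (snd x) = f j) (cells \<nu>)) = card {c \<in> set (cells \<nu>). snd c = j}"
  using distinct_card[OF distinct_filter[OF distinct_cells, of "\<lambda>x. f (snd x) = f j" \<nu>]]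
  by (simp add: inj_eq[OF assms])

lemma left_ideal_finsum:
  assumes "ring R" "left_ideal I R" "\<And>x. x \<in> A \<Longrightarrow> f x \<in> I"
  shows "finsum R f A \<in> I"
proof -
  interpret R: ring R by fact
  interpret I: additive_subgroup I R using assms(2) by (simp add: left_ideal_def)
  show ?thesis
  proof (cases "finite A")
    case True
    then show ?thesis using assms(3)
    proof (induction A rule: finite_induct)
      case (insert x A)
      have "finsum R f (insert x A) = f x \<oplus>\<^bsub>R\<^esub> finsum R f A"
        using insert I.a_Hcarr by (intro R.finsum_insert) auto
      then show ?case using insert by (simp add: I.a_closed)
    qed (simp add: I.zero_closed)
  \<comment> \<open>On an infinite index set \<open>finsum\<close> has the default value
    zero.\<close>
  qed (simp add: R.finsum_infinite I.zero_closed)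
qed

section \<open>Vanishing on highest weight vectors\<close>

context
  fixes m0 m1 n :: nat and lam \<mu> :: "nat list"
  assumes lam: "is_partition lam" and \<mu>: "is_partition \<mu>"
    and m1: "part (conj_partition lam) 0 \<le> m1"
begin

interpretation virtual_algebra m0 m1 n .

interpretation Y: young_positions "length (cells \<mu>)" "\<lambda>p. fst (cells \<mu> ! p)" "\<lambda>p. snd (cells \<mu> ! p)"
  by (rule young_positions_cells)

interpretation T: gl_rep tensor_scale X "tensor_act (length (cells \<mu>))"
  by (rule gl_rep_tensor)

lemma tensor_word_act: "T.word_act w = tensor_word (length (cells \<mu>)) w"
  by (simp add: T.word_act_def fun_eq_iff)

text \<open>The determinant tensor contains letters only, so its virtual multiplicities are zero and
  irregular products kill it. The rest of \<open>Irr\<close> follows because the annihilator is a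
  left ideal.\<close>

lemma Irr_annihilates_det: "Irr m0 m1 n \<subseteq> T.annihilator Y.det_tensor"
  unfolding Irr_def Let_def
proof (rule left_genideal_subset[OF T.left_ideal_annihilator], clarify)
  fix w assume w: "set w \<subseteq> X \<times> X" "irregular m0 m1 w"
  have "{p. p < length (cells \<mu>) \<and> Letter (snd (cells \<mu> ! p)) = \<gamma>} = {}" if "\<gamma> \<in> V" for \<gamma>
    using that by (auto simp: virtual_symbols_def)
  then have "tensor_word (length (cells \<mu>)) w Y.det_tensor = 0"
    using w(2) by (intro irregular_kills[OF Y.homogeneous_det]) auto
  then show "UEA_class X (gl_monomial w) \<in> T.annihilator Y.det_tensor"
    by (simp add: T.UEA_class_annihilator gl_monomial_closed[OF w(1)] T.act_monomial tensor_word_act)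
qed

text \<open>The hypothesis joins both cases of the theorem. A nonzero coordinate would fill the
  diagram of \<open>\<mu>\<close> with symbols distinct within each row, \<open>Beta j\<close>
  occurring \<open>part lam j\<close> times, and \<open>gale_ryser\<close> would then refute the
  hypothesis.\<close>

lemma tableau_kills_det:
  assumes "\<not> (sum_list lam \<le> sum_list \<mu> \<and>
      (sum_list \<mu> = sum_list lam \<longrightarrow> dominated_by lam (conj_partition \<mu>)))"
  shows "tensor_word (length (cells \<mu>)) (map (\<lambda>c. (dstar c, Letter (S c))) (cells (conj_partition lam)))
    Y.det_tensor = 0"
proof (rule ext, rule ccontr)
  let ?N = "length (cells \<mu>)" and ?\<nu> = "conj_partition lam"
  let ?w = "map (\<lambda>c. (dstar c, Letter (S c))) (cells ?\<nu>)"
  fix l assume "tensor_word ?N ?w Y.det_tensor l \<noteq> 0 l"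
  then have nonzero: "tensor_word ?N ?w Y.det_tensor l \<noteq> 0" by simp
  have alt: "Y.row_alternating (tensor_word ?N (map (\<lambda>c. (dstar c, Letter (S c))) C) Y.det_tensor)" for C
    by (induction C) (auto simp: dstar_def Y.row_alternating_det intro!: Y.row_alternating_act)
  have le: "(\<Sum>j<t. occurrences ?N (Beta j) l) \<le> (\<Sum>j<t. card {p. p < ?N \<and> snd (cells \<mu> ! p) = j})" for t
    using Y.row_alternating_repeated[OF alt] nonzero by (intro Y.gale_ryser) blast
  have "occurrences ?N (Beta j) l = part lam j" for j
  proof -
    have "filter (\<lambda>x. fst x = Beta j) ?w = map (\<lambda>c. (dstar c, Letter (S c))) (filter (\<lambda>c. Beta (snd c) = Beta j) (cells ?\<nu>))"
      by (auto simp: filter_map dstar_def o_def split_def)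
    then have A: "length (filter (\<lambda>x. fst x = Beta j) ?w) = part lam j"
      using filter_cells_count[of Beta j ?\<nu>] card_column_conj[OF lam, of j] by (simp add: inj_def)
    \<comment> \<open>Neither the tableau entries nor the determinant tensor contribute beta
      symbols, so only the first components of the word count.\<close>
    have B: "filter (\<lambda>x. snd x = Beta j) ?w = []" by (auto simp: filter_empty_conv)
    have C: "{p. p < ?N \<and> Letter (snd (cells \<mu> ! p)) = Beta j} = {}" by auto
    have "int (occurrences ?N (Beta j) l) = int (card {p. p < ?N \<and> Letter (snd (cells \<mu> ! p)) = Beta j})
        + int (length (filter (\<lambda>x. fst x = Beta j) ?w)) - int (length (filter (\<lambda>x. snd x = Beta j) ?w))"
      using homogeneous_tensor_word[OF Y.homogeneous_det, of ?w] nonzero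
      unfolding homogeneous_def by blast
    then show ?thesis unfolding A B C by simp
  qed
  then have le: "(\<Sum>j<t. part lam j) \<le> (\<Sum>j<t. part (conj_partition \<mu>) j)" for t
    using le[of t] by (simp add: card_index_column card_column part_conj[OF \<mu>])
  have "(\<Sum>j<t. part (conj_partition \<mu>) j) \<le> sum_list \<mu>" for t
  proof -
    have "(\<Sum>j<t. part (conj_partition \<mu>) j) = (\<Sum>j<t. card {p. p < ?N \<and> snd (cells \<mu> ! p) = j})"
      by (simp add: card_index_column card_column part_conj[OF \<mu>])
    also have "\<dots> = card (\<Union>j<t. {p. p < ?N \<and> snd (cells \<mu> ! p) = j})"
      by (subst card_UN_disjoint) auto
    also have "\<dots> \<le> card {..<?N}" by (rule card_mono) auto
    finally show ?thesis by (simp add: length_cells)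
  qed
  \<comment> \<open>At \<open>t = length lam\<close> the left side has reached the full size of
    \<open>lam\<close>.\<close>
  with le[of "length lam"] have "sum_list lam \<le> sum_list \<mu>"
    unfolding sum_part by (meson order_trans)
  moreover have "dominated_by lam (conj_partition \<mu>)" if "sum_list \<mu> = sum_list lam"
    using that le by (simp add: dominated_by_def sum_conj_partition[OF \<mu>])
  ultimately show False using assms by blast
qed

text \<open>The annihilator of \<open>v\<close> is a left ideal, so it suffices to treat the
  projection for a single tableau.\<close>

lemma J_annihilates:
  fixes scale :: "complex \<Rightarrow> 'v::ab_group_add \<Rightarrow> 'v"
  assumes irr: "irreducible_gl_module n scale \<rho>"
    and v: "highest_weight_vector n scale \<rho> (schur_weight \<mu>) v"
    and not: "\<not> (sum_list lam \<le> sum_list \<mu> \<and>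
      (sum_list \<mu> = sum_list lam \<longrightarrow> dominated_by lam (conj_partition \<mu>)))"
  shows "UEA_act scale \<rho> (J m0 m1 n lam) v = 0"
proof -
  let ?N = "length (cells \<mu>)" and ?\<nu> = "conj_partition lam"
  interpret R: gl_rep scale L \<rho>
    using irr by (intro gl_module_imp_gl_rep) (simp add: irreducible_gl_module_def)
  have hw: "highest_weight_vector n tensor_scale (tensor_act ?N) (schur_weight \<mu>) Y.det_tensor"
    using Y.highest_weight_det[of n]
    by (simp add: card_index_column card_column part_conj[OF \<mu>, symmetric] schur_weight_def[abs_def])
  \<comment> \<open>For empty \<open>lam\<close>, where \<open>J\<close> is 1, the condition negated
    in \<open>not\<close> holds, so this case is excluded.\<close>
  have "lam \<noteq> []"
    using not by (auto simp: dominated_by_def Defs.part_def sum_conj_partition[OF \<mu>])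
  moreover have "virt_proj m0 m1 n
      (UEA_class X (tableau_monomial ?\<nu> (Letter \<circ> S) dstar) \<otimes>\<^bsub>gl_UEA X\<^esub>
       UEA_class X (tableau_monomial ?\<nu> dstar (Letter \<circ> S))) \<in> R.annihilator v"
    if S: "S \<in> column_tableaux n ?\<nu>" for S
  proof -
    let ?w1 = "map (\<lambda>c. (Letter (S c), dstar c)) (cells ?\<nu>)"
    let ?w2 = "map (\<lambda>c. (dstar c, Letter (S c))) (cells ?\<nu>)"
    have "dstar c \<in> V" if "c \<in> set (cells ?\<nu>)" for c
      using that m1 conj_partition_nth_le[of "fst c" lam]
      by (auto simp: set_cells dstar_def virtual_symbols_def split_def)
    moreover have "Letter (S c) \<in> L" if "c \<in> set (cells ?\<nu>)" for c
      using S that by (auto simp: column_tableaux_def proper_symbols_def)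
    ultimately have w: "set ?w1 \<subseteq> L \<times> V" "set ?w2 \<subseteq> V \<times> L" by auto
    then have closed: "set ?w1 \<subseteq> X \<times> X" "set ?w2 \<subseteq> X \<times> X" unfolding symbols(1) by blast+
    have closed': "set (?w1 @ ?w2) \<subseteq> X \<times> X" using closed by auto
    have 1: "(\<Sum>x\<leftarrow>w1. vdeg x) = - int (length w1)" if "set w1 \<subseteq> L \<times> V" for w1
      using that symbols(2) by (induction w1) (auto simp: vdeg_def)
    have 2: "(\<Sum>x\<leftarrow>w2. vdeg x) = int (length w2)" if "set w2 \<subseteq> V \<times> L" for w2
      using that symbols(2) by (induction w2) (auto simp: vdeg_def)
    \<comment> \<open>The first word removes as many virtual symbols as the second creates, which
      puts the product in degree zero.\<close>
    have "(\<Sum>x\<leftarrow>?w1 @ ?w2. vdeg x) = 0"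
      unfolding map_append sum_list_append 1[OF w(1)] 2[OF w(2)] by simp
    then obtain p where p: "p \<in> carrier (free_algebra L)"
      and proj: "virt_proj m0 m1 n (UEA_class X (gl_monomial (?w1 @ ?w2))) = UEA_class L p"
      and irr_p: "UEA_class X (gl_monomial (?w1 @ ?w2) - p) \<in> Irr m0 m1 n"
      by (rule virt_proj_monomial[OF closed'])
    have pX: "p \<in> carrier (free_algebra X)" using p symbols(1) by (auto simp: free_algebra_def)
    have wX: "gl_monomial (?w1 @ ?w2) \<in> carrier (free_algebra X)"
      by (rule gl_monomial_closed[OF closed'])
    \<comment> \<open>The product and its projection differ by an element of \<open>Irr\<close>, so
      they act alike on the determinant tensor, which the right half \<open>?w2\<close> already
      kills.\<close>
    have "T.act (gl_monomial (?w1 @ ?w2) - p) Y.det_tensor = 0"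
      using irr_p Irr_annihilates_det T.UEA_class_annihilator[OF free_algebra_closed(4)[OF wX pX]] by blast
    then have "T.act p Y.det_tensor = T.word_act ?w1 (T.word_act ?w2 Y.det_tensor)"
      by (simp add: T.act_diff T.act_monomial)
    also have "T.word_act ?w2 Y.det_tensor = 0"
      unfolding tensor_word_act by (rule tableau_kills_det[OF not])
    finally have "T.act p Y.det_tensor = 0"
      by (simp only: tensor_word_act tensor_word_zero)
    then have "R.act p v = 0"
      by (rule highest_weight_annihilator[OF gl_rep_tensor irr hw v p])
    then have "UEA_class L p \<in> R.annihilator v" using p by (simp add: R.UEA_class_annihilator)
    moreover have "gl_monomial ?w1 * gl_monomial ?w2 = gl_monomial (?w1 @ ?w2)"
      by (simp add: gl_monomial_def mult_single plus_gl_word_def)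
    moreover have "UEA_class X (gl_monomial ?w1) \<otimes>\<^bsub>gl_UEA X\<^esub> UEA_class X (gl_monomial ?w2)
        = UEA_class X (gl_monomial ?w1 * gl_monomial ?w2)"
      using closed by (intro UEA_class_mult[symmetric] gl_monomial_closed)
    ultimately show ?thesis
      unfolding tableau_monomial_def comp_apply by (simp only: proj)
  qed
  ultimately have "J m0 m1 n lam \<in> R.annihilator v"
    unfolding J_def Let_def if_not_P[OF \<open>lam \<noteq> []\<close>]
    using R.left_ideal_annihilator[of v] UEA_class_closed[OF gl_scalar_closed]
    by (intro left_ideal_finsum[OF ring_gl_UEA]) (auto simp: left_ideal_def)
  then show ?thesis by (rule R.UEA_act_annihilator)
qed

end

theorem proposition4p39:
  fixes m0 m1 n :: nat
    and lam \<mu> :: "nat list"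
    and scale :: "complex \<Rightarrow> 'v::ab_group_add \<Rightarrow> 'v"
    and \<rho> :: "symbol \<Rightarrow> symbol \<Rightarrow> 'v \<Rightarrow> 'v"
    and v :: 'v
  assumes "n \<ge> 1"
    and "is_partition lam"
    and "is_partition \<mu>"
    and "part \<mu> 0 \<le> n"
    and "part (conj_partition lam) 0 \<le> m1"
    and "schur_module n \<mu> scale \<rho>"
    and "highest_weight_vector n scale \<rho> (schur_weight \<mu>) v"
  shows "(sum_list \<mu> < sum_list lam \<longrightarrow> UEA_act scale \<rho> (J m0 m1 n lam) v = 0) \<and>
         (sum_list \<mu> = sum_list lam \<and> \<not> dominated_by lam (conj_partition \<mu>)
            \<longrightarrow> UEA_act scale \<rho> (J m0 m1 n lam) v = 0)"
  \<comment> \<open>Each of the two cases violates the condition negated in the last premise of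
    \<open>J_annihilates\<close>.\<close>
  using J_annihilates[of lam \<mu> m1 n scale \<rho> v m0] assms
  by (auto simp: schur_module_def)

end
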